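(* Let $W:\mathbb{R}\to\mathbb{R}$ be a $C^2$ function such that (i) $0=W(0)<W(v)$ for all $v\in\mathbb{R}\setminus\{0\}$; (ii) $\liminf_{|v|\to+\infty}W(v)>0$; (iii) $W''(0)>0$. Let $\Omega\subset\mathbb{R}^n$ be a domain and $u\in C^1(\Omega;\mathbb{R})$ a local minimizer of the Allen–Cahn energy satisfying $|u|+|\nabla u|\leq M_0$ in $\Omega$ for some $M_0>0$. Then there is $q^*>0$ with the property that for each $q\in(0,q^*]$ there is $R(q)>0$ such that $$B_{x,R(q)}\subset\Omega\ \Rightarrow\ |u(x)|<q.$$ Moreover $R(q)$ can be chosen strictly decreasing and continuous on $(0,q^*]$, and its inverse map $q(R)$ satisfies $q(R)\leq Ke^{-kR}$ for $R\in[R(q^* ),+\infty)$, for some positive constants $k,K$ depending only on $W$, $n$ and $M_0$.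
   Context: For a bounded domain $A\subset\mathbb{R}^n$ and $w\in W^{1,2}(A;\mathbb{R})$, $J_A(w)=\int_A(\frac12|\nabla w|^2+W(w))\,dx$. A map $u\in W^{1,2}_{\rm loc}(\Omega;\mathbb{R})$ is a local minimizer of the Allen–Cahn energy if $J_A(u)=\min_{v\in W^{1,2}_0(A;\mathbb{R})}J_A(u+v)$ for every bounded Lipschitz domain $A\subset\Omega$. The condition $0=W(0)<W(v)$ is meant for $v\neq 0$. $B_{x,R}$ is the open ball of center $x$ and radius $R$. *)

theory Defs
  imports "HOL-Analysis.Analysis"
begin

definition pd :: "'n::finite \<Rightarrow> (real^'n \<Rightarrow> real) \<Rightarrow> real^'n \<Rightarrow> real" where
  "pd i f x = frechet_derivative f (at x) (axis i 1)"

fun iter_pd :: "'n::finite list \<Rightarrow> (real^'n \<Rightarrow> real) \<Rightarrow> real^'n \<Rightarrow> real" where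
  "iter_pd [] f = f"
| "iter_pd (i # is) f = pd i (iter_pd is f)"

definition grad :: "(real^'n::finite \<Rightarrow> real) \<Rightarrow> real^'n \<Rightarrow> real^'n" where
  "grad f x = (\<chi> i. pd i f x)"

definition smooth_fun :: "(real^'n::finite \<Rightarrow> real) \<Rightarrow> bool" where
  "smooth_fun f \<longleftrightarrow> (\<forall>is x. iter_pd is f differentiable (at x))"

definition test_fun :: "(real^'n::finite) set \<Rightarrow> (real^'n \<Rightarrow> real) \<Rightarrow> bool" where
  "test_fun A \<phi> \<longleftrightarrow> smooth_fun \<phi> \<and>
     (\<exists>K. compact K \<and> K \<subseteq> A \<and> (\<forall>x. x \<notin> K \<longrightarrow> \<phi> x = 0))"

definition L2 :: "(real^'n::finite) set \<Rightarrow> (real^'n \<Rightarrow> real) \<Rightarrow> bool" where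
  "L2 A f \<longleftrightarrow> f \<in> borel_measurable (lebesgue_on A) \<and> integrable (lebesgue_on A) (\<lambda>x. (f x)\<^sup>2)"

definition W12 :: "(real^'n::finite) set \<Rightarrow> (real^'n \<Rightarrow> real) \<Rightarrow> (real^'n \<Rightarrow> real^'n) \<Rightarrow> bool" where
  "W12 A w g \<longleftrightarrow> L2 A w \<and> (\<forall>i. L2 A (\<lambda>x. g x $ i)) \<and>
     (\<forall>\<phi> i. test_fun A \<phi> \<longrightarrow>
        integral\<^sup>L (lebesgue_on A) (\<lambda>x. w x * pd i \<phi> x)
          = - integral\<^sup>L (lebesgue_on A) (\<lambda>x. g x $ i * \<phi> x))"

definition W12_0 :: "(real^'n::finite) set \<Rightarrow> (real^'n \<Rightarrow> real) \<Rightarrow> (real^'n \<Rightarrow> real^'n) \<Rightarrow> bool" where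
  "W12_0 A w g \<longleftrightarrow> W12 A w g \<and>
     (\<exists>\<phi>s :: nat \<Rightarrow> real^'n \<Rightarrow> real. (\<forall>k. test_fun A (\<phi>s k)) \<and>
        (\<lambda>k. integral\<^sup>L (lebesgue_on A) (\<lambda>x. (\<phi>s k x - w x)\<^sup>2)) \<longlonglongrightarrow> 0 \<and>
        (\<lambda>k. integral\<^sup>L (lebesgue_on A) (\<lambda>x. (norm (grad (\<phi>s k) x - g x))\<^sup>2)) \<longlonglongrightarrow> 0)"

definition lipschitz_domain :: "(real^'n::finite) set \<Rightarrow> bool" where
  "lipschitz_domain A \<longleftrightarrow> open A \<and> connected A \<and> A \<noteq> {} \<and>
     (\<forall>p\<in>frontier A. \<exists>r>0. \<exists>T j (\<gamma> :: real^'n \<Rightarrow> real) L.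
        orthogonal_transformation T \<and> lipschitz_on L UNIV \<gamma> \<and>
        (\<forall>y z. (\<forall>i. i \<noteq> j \<longrightarrow> y $ i = z $ i) \<longrightarrow> \<gamma> y = \<gamma> z) \<and>
        A \<inter> ball p r = {x \<in> ball p r. T (x - p) $ j > \<gamma> (T (x - p))})"

text \<open>J_A(w) for w with (weak) gradient Dw; W is nonnegative, so use the nonnegative integral.\<close>
definition AC_energy :: "(real \<Rightarrow> real) \<Rightarrow> (real^'n::finite) set \<Rightarrow> (real^'n \<Rightarrow> real)
     \<Rightarrow> (real^'n \<Rightarrow> real^'n) \<Rightarrow> ennreal" where
  "AC_energy W A w Dw = (\<integral>\<^sup>+ x. ennreal (1/2 * (norm (Dw x))\<^sup>2 + W (w x)) \<partial>lebesgue_on A)"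

definition AC_local_min :: "(real \<Rightarrow> real) \<Rightarrow> (real^'n::finite) set \<Rightarrow> (real^'n \<Rightarrow> real)
     \<Rightarrow> (real^'n \<Rightarrow> real^'n) \<Rightarrow> bool" where
  "AC_local_min W \<Omega> u Du \<longleftrightarrow>
     (\<forall>A. bounded A \<and> lipschitz_domain A \<and> A \<subseteq> \<Omega> \<longrightarrow>
        W12 A u Du \<and>
        (\<forall>v g. W12_0 A v g \<longrightarrow>
            AC_energy W A u Du \<le> AC_energy W A (\<lambda>x. u x + v x) (\<lambda>x. Du x + g x)))"

end

theory Submission
  imports Defs
begin

text \<open>Since \<open>\<bar>u\<bar> \<le> M\<^sub>0\<close> and \<open>W\<close> has a single nondegenerate well, \<open>W v\<close> is comparable to \<open>v\<^sup>2\<close> on the range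
  of \<open>u\<close>, so no maximum principle or density estimate is needed. Let \<open>E r\<close> be the integral of
  \<open>norm (Du)\<^sup>2 + u\<^sup>2\<close> over the ball of radius \<open>r\<close> around \<open>x\<close>. Comparing \<open>u\<close> on the ball of radius \<open>r + 1\<close>
  with \<open>\<eta> u\<close>, where \<open>\<eta>\<close> vanishes on the ball of radius \<open>r\<close> and equals 1 near the boundary, gives
  \<open>c * E (r + 1) \<le> C * (E (r + 1) - E r)\<close>, that is \<open>E r \<le> \<theta> * E (r + 1)\<close> with a fixed \<open>\<theta> < 1\<close>.
  Iterating from \<open>E R = O(R ^ n)\<close> makes \<open>E 1\<close> exponentially small in \<open>R\<close>, while the bound on the gradient
  gives \<open>E 1 \<ge> c * \<bar>u x\<bar> ^ (n + 2)\<close>. Hence \<open>\<bar>u x\<bar> \<le> K * exp (- k * R)\<close>, and \<open>R q\<close> is obtained by solving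
  \<open>q = 2 * K * exp (- k * R)\<close>. The competitor is admissible because mollification
  approximates \<open>(\<eta> - 1) * u\<close> by test functions in \<open>W\<^sup>1\<^sup>2\<close>.\<close>

section \<open>Smooth functions\<close>

lemma pd_eq:
  assumes "(f has_derivative f') (at x)"
  shows "pd i f x = f' (axis i 1)"
  using frechet_derivative_at[OF assms] by (simp add: pd_def)

text \<open>The head of the list is the outermost derivative and the last entry the innermost;
  peeling off the last entry is what lets smoothness pass from \<open>f\<close> to
  \<open>pd i f\<close>.\<close>

lemma iter_pd_snoc: "iter_pd (is @ [i]) f = iter_pd is (pd i f)"
  by (induction "is") auto

lemma smooth_fun_pd: "smooth_fun f \<Longrightarrow> smooth_fun (pd i f)"
  unfolding smooth_fun_def by (metis iter_pd_snoc)

lemma smooth_fun_differentiable: "smooth_fun f \<Longrightarrow> f differentiable (at x)"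
  unfolding smooth_fun_def by (metis iter_pd.simps(1))

text \<open>Induction on the list of directions keeps every iterated derivative inside
  \<open>S\<close>. Smoothness is thus reduced to finding a class of differentiable functions that
  is closed under \<open>pd\<close>.\<close>

lemma smooth_fun_coinduct:
  assumes "f \<in> S"
    and "\<And>f x. f \<in> S \<Longrightarrow> f differentiable (at x)"
    and "\<And>f i. f \<in> S \<Longrightarrow> pd i f \<in> S"
  shows "smooth_fun f"
proof -
  have "iter_pd is f \<in> S" for "is"
    by (induction "is") (auto intro: assms)
  then show ?thesis
    unfolding smooth_fun_def using assms(2) by blast
qed

lemma grad_nth [simp]: "grad f x $ i = pd i f x"
  by (simp add: grad_def)

lemma has_derivative_grad:
  assumes "f differentiable (at x)"
  shows "(f has_derivative (\<lambda>h. grad f x \<bullet> h)) (at x)"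
proof -
  obtain f' where f': "(f has_derivative f') (at x)"
    using assms by (auto simp: differentiable_def)
  interpret bounded_linear f' by (rule has_derivative_bounded_linear[OF f'])
  have "f' h = grad f x \<bullet> h" for h
  proof -
    have "f' h = f' (\<Sum>i\<in>UNIV. h $ i *\<^sub>R axis i 1)"
      using basis_expansion[of h] by (simp add: scalar_mult_eq_scaleR)
    also have "\<dots> = grad f x \<bullet> h"
      by (simp add: sum scaleR inner_vec_def pd_eq[OF f'] mult.commute)
    finally show ?thesis .
  qed
  then show ?thesis using f' by presburger
qed

lemma grad_eqI:
  assumes "(f has_derivative (\<lambda>h. g \<bullet> h)) (at x)"
  shows "grad f x = g"
  by (simp add: vec_eq_iff pd_eq[OF assms] inner_axis)

lemma smooth_fun_has_derivative:
  "smooth_fun f \<Longrightarrow> (f has_derivative (\<lambda>h. grad f x \<bullet> h)) (at x)"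
  by (intro has_derivative_grad smooth_fun_differentiable)

lemma smooth_fun_continuous: "smooth_fun f \<Longrightarrow> continuous_on S f"
  by (intro continuous_at_imp_continuous_on ballI differentiable_imp_continuous_within
      smooth_fun_differentiable)

lemma continuous_grad: "smooth_fun f \<Longrightarrow> continuous_on S (grad f)"
  unfolding grad_def
  by (intro continuous_on_vec_lambda) (blast intro: smooth_fun_continuous smooth_fun_pd)

lemma pd_add:
  assumes "f differentiable (at x)" "g differentiable (at x)"
  shows "pd i (\<lambda>x. f x + g x) x = pd i f x + pd i g x"
  using pd_eq[OF has_derivative_add[OF assms[THEN has_derivative_grad]]]
  by (simp add: inner_axis)

lemma pd_mult:
  assumes "f differentiable (at x)" "g differentiable (at x)"
  shows "pd i (\<lambda>x. f x * g x) x = f x * pd i g x + pd i f x * g x"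
  using pd_eq[OF has_derivative_mult[OF assms[THEN has_derivative_grad]]]
  by (simp add: inner_axis)

section \<open>Algebras of smooth functions\<close>

text \<open>The real algebra generated by \<open>G\<close> and the constants. Derivatives of the
  generators used below are seldom generators themselves, but they are polynomials in
  generators.\<close>

inductive_set fun_alg :: "(real^'n::finite \<Rightarrow> real) set \<Rightarrow> (real^'n \<Rightarrow> real) set"
  for G where
  gen: "g \<in> G \<Longrightarrow> g \<in> fun_alg G"
| const: "(\<lambda>x. c) \<in> fun_alg G"
| add: "f \<in> fun_alg G \<Longrightarrow> g \<in> fun_alg G \<Longrightarrow> (\<lambda>x. f x + g x) \<in> fun_alg G"
| mult: "f \<in> fun_alg G \<Longrightarrow> g \<in> fun_alg G \<Longrightarrow> (\<lambda>x. f x * g x) \<in> fun_alg G"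

text \<open>The sum and product rules carry closure under \<open>pd\<close> from the generators to
  the whole algebra, which then serves as the invariant class of
  \<open>smooth_fun_coinduct\<close>.\<close>

lemma smooth_fun_alg:
  fixes f :: "real^'n::finite \<Rightarrow> real"
  assumes "f \<in> fun_alg G"
    and G: "\<And>g x. g \<in> G \<Longrightarrow> g differentiable (at x)"
      "\<And>g i. g \<in> G \<Longrightarrow> pd i g \<in> fun_alg G"
  shows "smooth_fun f"
proof -
  have "(\<forall>x. f differentiable (at x)) \<and> (\<forall>i. pd i f \<in> fun_alg G)" if "f \<in> fun_alg G" for f
    using that
  proof induction
    case (const c)
    have "pd i (\<lambda>x::real^'n. c) = (\<lambda>x. 0)" for i
      by (rule ext) (simp add: pd_eq[OF has_derivative_const])
    then show ?case using fun_alg.const[of 0 G] by simp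
  next
    case (add f g)
    then have "pd i (\<lambda>x. f x + g x) = (\<lambda>x. pd i f x + pd i g x)" for i
      by (intro ext pd_add) auto
    then show ?case using add by (auto intro!: fun_alg.add)
  next
    case (mult f g)
    then have "pd i (\<lambda>x. f x * g x) = (\<lambda>x. f x * pd i g x + pd i f x * g x)" for i
      by (intro ext pd_mult) auto
    then show ?case using mult by (auto intro!: fun_alg.add fun_alg.mult)
  qed (use G in auto)
  then show ?thesis
    by (intro smooth_fun_coinduct[OF assms(1)]) blast+
qed

lemma smooth_fun_add: "smooth_fun f \<Longrightarrow> smooth_fun g \<Longrightarrow> smooth_fun (\<lambda>x. f x + g x)"
  by (rule smooth_fun_alg[where G = "Collect smooth_fun"])
    (auto intro: fun_alg.intros smooth_fun_pd smooth_fun_differentiable)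

lemma smooth_fun_mult: "smooth_fun f \<Longrightarrow> smooth_fun g \<Longrightarrow> smooth_fun (\<lambda>x. f x * g x)"
  by (rule smooth_fun_alg[where G = "Collect smooth_fun"])
    (auto intro: fun_alg.intros smooth_fun_pd smooth_fun_differentiable)

lemma smooth_fun_const: "smooth_fun (\<lambda>x. c)"
  by (rule smooth_fun_alg[where G = "{}"]) (auto intro: fun_alg.intros)

text \<open>The derivative of 1/f is a product of -1, 1/f twice and a derivative of f. One extra
  generator 1/f beside the smooth functions therefore suffices.\<close>

lemma smooth_fun_inverse:
  fixes f :: "real^'n::finite \<Rightarrow> real"
  assumes f: "smooth_fun f" and nz: "\<And>x. f x \<noteq> 0"
  shows "smooth_fun (\<lambda>x. inverse (f x))"
proof (rule smooth_fun_alg[where G = "insert (\<lambda>x. inverse (f x)) (Collect smooth_fun)"])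
  let ?G = "insert (\<lambda>x. inverse (f x)) (Collect smooth_fun)"
  show "(\<lambda>x. inverse (f x)) \<in> fun_alg ?G" by (auto intro: fun_alg.gen)
  fix g :: "real^'n \<Rightarrow> real" assume g: "g \<in> ?G"
  have der: "((\<lambda>x. inverse (f x)) has_derivative
      (\<lambda>h. - (inverse (f x) * (grad f x \<bullet> h) * inverse (f x)))) (at x)" for x
    by (rule Deriv.has_derivative_inverse[OF nz smooth_fun_has_derivative[OF f]])
  show "g differentiable (at x)" for x
    using g der[of x] by (auto simp: differentiable_def[of "\<lambda>x. inverse (f x)"]
        intro: smooth_fun_differentiable)
  show "pd i g \<in> fun_alg ?G" for i
  proof (cases "smooth_fun g")
    case True
    then show ?thesis by (auto intro: fun_alg.gen smooth_fun_pd)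
  next
    case False
    then have [simp]: "g = (\<lambda>x. inverse (f x))" using g by auto
    have "pd i g = (\<lambda>x. (- 1) * (inverse (f x) * (pd i f x * inverse (f x))))"
      using pd_eq[OF der] by (auto simp: fun_eq_iff inner_axis mult_ac)
    moreover have "pd i f \<in> fun_alg ?G" "(\<lambda>x. inverse (f x)) \<in> fun_alg ?G"
      using f by (auto intro: fun_alg.gen smooth_fun_pd)
    ultimately show ?thesis
      by (simp only: fun_alg.mult fun_alg.const)
  qed
qed

text \<open>Reflections arise from convolution kernels \<open>\<rho> (x - y)\<close>, read as
  functions of the integration variable \<open>y\<close>; this is where the sign in integration by
  parts comes from.\<close>

lemma reflect_has_derivative:
  assumes "smooth_fun f"
  shows "((\<lambda>y. f (x - y)) has_derivative (\<lambda>h. - (grad f (x - y) \<bullet> h))) (at y)"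
proof -
  have "((\<lambda>y. x - y) has_derivative uminus) (at y)"
    by (auto intro!: derivative_eq_intros)
  from has_derivative_compose[OF this smooth_fun_has_derivative[OF assms]]
  show ?thesis by simp
qed

lemma pd_reflect: "smooth_fun f \<Longrightarrow> pd i (\<lambda>y. f (x - y)) y = - pd i f (x - y)"
  using pd_eq[OF reflect_has_derivative] by (fastforce simp: inner_axis)

lemma smooth_fun_reflect:
  assumes "smooth_fun f"
  shows "smooth_fun (\<lambda>y. f (x - y))"
proof (rule smooth_fun_alg[where G = "{(\<lambda>y. g (x - y)) | g. smooth_fun g}"])
  let ?G = "{(\<lambda>y. g (x - y)) | g. smooth_fun g}"
  show "(\<lambda>y. f (x - y)) \<in> fun_alg ?G" using assms by (auto intro: fun_alg.gen)
  fix h assume "h \<in> ?G"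
  then obtain g where g: "smooth_fun g" and [simp]: "h = (\<lambda>y. g (x - y))" by auto
  show "h differentiable (at y)" for y
    using reflect_has_derivative[OF g] by (auto simp: differentiable_def)
  have "pd i h = (\<lambda>y. (- 1) * pd i g (x - y))" for i
    by (simp add: fun_eq_iff pd_reflect[OF g])
  moreover have "(\<lambda>y. pd i g (x - y)) \<in> fun_alg ?G" for i
    by (rule fun_alg.gen) (use g smooth_fun_pd in auto)
  ultimately show "pd i h \<in> fun_alg ?G" for i
    by (simp only: fun_alg.mult fun_alg.const)
qed

subsection \<open>Flat functions and cutoffs\<close>

text \<open>The classical function exp(-1/t), extended by zero to t \<le> 0, with a polynomial
  factor in 1/t so that the family is closed under differentiation.\<close>

definition flat :: "real poly \<Rightarrow> real \<Rightarrow> real" where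
  "flat p t = (if t > 0 then poly p (1 / t) * exp (- 1 / t) else 0)"

lemma tendsto_poly_exp:
  fixes p :: "real poly"
  shows "((\<lambda>s. poly p s * exp (- s)) \<longlongrightarrow> 0) at_top"
proof -
  \<comment> \<open>The extra power of \<open>s\<close> makes the induction go through: removing a
    coefficient from \<open>pCons a p\<close> raises \<open>k\<close> by one.\<close>
  have "((\<lambda>s. s ^ k * poly p s * exp (- s)) \<longlongrightarrow> 0) at_top" for k
  proof (induction p arbitrary: k)
    case (pCons a p)
    have "((\<lambda>s::real. a * (s ^ k / exp s) + s ^ Suc k * poly p s * exp (- s)) \<longlongrightarrow> a * 0 + 0) at_top"
      by (intro tendsto_intros pCons.IH tendsto_power_div_exp_0)
    then show ?case
      by (simp add: algebra_simps exp_minus divide_inverse)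
  qed simp
  from this[of 0] show ?thesis by simp
qed

lemma tendsto_flat_0: "(flat p \<longlongrightarrow> 0) (at 0)"
proof -
  have "((\<lambda>t. poly p (inverse t) * exp (- inverse t)) \<longlongrightarrow> 0) (at_right 0)"
    by (rule filterlim_compose[OF tendsto_poly_exp filterlim_inverse_at_top_right])
  then have "(flat p \<longlongrightarrow> 0) (at_right 0)"
    by (rule tendsto_cong[THEN iffD1, rotated])
      (auto simp: flat_def eventually_at_filter divide_inverse)
  moreover have "(flat p \<longlongrightarrow> 0) (at_left 0)"
    by (rule tendsto_eventually) (auto simp: flat_def eventually_at_filter)
  ultimately show ?thesis by (simp add: filterlim_split_at)
qed

text \<open>For t > 0 put s = 1/t: the derivative of p(s) exp(-s) in t is s^2 (p - p')(s) exp(-s).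
  At t = 0 the difference quotient is again flat, with \<open>p\<close> multiplied by the variable,
  so it tends to 0.\<close>

lemma flat_has_derivative:
  "(flat p has_real_derivative flat ([:0, 0, 1:] * (p - pderiv p)) t) (at t)"
proof (cases "t = 0")
  case True
  have "(\<lambda>h. (flat p (0 + h) - flat p 0) / h) = flat ([:0, 1:] * p)"
    by (auto simp: fun_eq_iff flat_def)
  then have "(flat p has_real_derivative 0) (at 0)"
    unfolding DERIV_def using tendsto_flat_0 by metis
  then show ?thesis using True by (simp add: flat_def)
next
  case False
  show ?thesis
  proof (cases "t > 0")
    case True
    have "((\<lambda>t. poly p (1 / t) * exp (- 1 / t)) has_real_derivative
        flat ([:0, 0, 1:] * (p - pderiv p)) t) (at t)"
      using True
      by (auto intro!: derivative_eq_intros poly_DERIV[THEN DERIV_chain2]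
          simp: flat_def field_simps power2_eq_square)
    then show ?thesis
      by (rule has_field_derivative_transform_within_open[where S = "{0<..}"])
        (use True in \<open>auto simp: flat_def\<close>)
  next
    case nle: False
    have "((\<lambda>t. 0) has_real_derivative 0) (at t)" by simp
    then have "(flat p has_real_derivative 0) (at t)"
      by (rule has_field_derivative_transform_within_open[where S = "{..<0}"])
        (use False nle in \<open>auto simp: flat_def\<close>)
    then show ?thesis using False nle by (simp add: flat_def)
  qed
qed

lemma continuous_on_flat: "continuous_on S (flat p)"
  by (meson flat_has_derivative DERIV_isCont continuous_at_imp_continuous_on)

text \<open>The chain rule brings out the factor \<open>y $ i - a $ i\<close>, so the coordinate
  functions join the flat profiles as generators.\<close>

lemma smooth_fun_flat_norm:
  fixes a :: "real^'n::finite"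
  shows "smooth_fun (\<lambda>y. flat p (c * (norm (y - a))\<^sup>2 + d))"
proof -
  define G where "G = {\<lambda>y::real^'n. flat p (c * (norm (y - a))\<^sup>2 + d) | p. True} \<union> {\<lambda>y. y $ i | i. True}"
  have der: "((\<lambda>y. flat p (c * (norm (y - a))\<^sup>2 + d)) has_derivative
      (\<lambda>h. flat ([:0, 0, 1:] * (p - pderiv p)) (c * (norm (y - a))\<^sup>2 + d) * (2 * c * ((y - a) \<bullet> h)))) (at y)"
    for p y
  proof -
    have "((\<lambda>y. c * (norm (y - a))\<^sup>2 + d) has_derivative (\<lambda>h. 2 * c * ((y - a) \<bullet> h))) (at y)"
      unfolding power2_norm_eq_inner
      by (auto intro!: derivative_eq_intros simp: inner_commute algebra_simps fun_eq_iff)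
    from has_derivative_compose[OF this flat_has_derivative[unfolded has_field_derivative_def]]
    show ?thesis by simp
  qed
  have nth: "((\<lambda>y::real^'n. y $ i) has_derivative (\<lambda>h. h $ i)) (at y)" for i y
    by (intro bounded_linear_imp_has_derivative bounded_linear_vec_nth)
  show ?thesis
  proof (rule smooth_fun_alg)
    show "(\<lambda>y. flat p (c * (norm (y - a))\<^sup>2 + d)) \<in> fun_alg G"
      by (intro fun_alg.gen) (auto simp: G_def)
    show "g differentiable (at x)" if "g \<in> G" for g x
      using that der nth unfolding G_def differentiable_def by blast
    show "pd i g \<in> fun_alg G" if "g \<in> G" for g i
    proof -
      consider p where "g = (\<lambda>y. flat p (c * (norm (y - a))\<^sup>2 + d))" | j where "g = (\<lambda>y. y $ j)"
        using \<open>g \<in> G\<close> unfolding G_def by blast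
      then show ?thesis
      proof cases
      case g: (1 p)
      have "pd i g = (\<lambda>y. flat ([:0, 0, 1:] * (p - pderiv p)) (c * (norm (y - a))\<^sup>2 + d)
          * (2 * c * (y $ i + (- (a $ i)))))"
        unfolding g by (auto simp: fun_eq_iff pd_eq[OF der] inner_axis)
      moreover have "(\<lambda>y. flat p' (c * (norm (y - a))\<^sup>2 + d)) \<in> fun_alg G"
        "(\<lambda>y. y $ i) \<in> fun_alg G" for p'
        by (intro fun_alg.gen; auto simp: G_def)+
      ultimately show ?thesis
        by (simp only: fun_alg.mult fun_alg.add fun_alg.const)
    next
      case g: (2 j)
      have "pd i g = (\<lambda>y. axis i 1 $ j)"
        unfolding g by (simp add: fun_eq_iff pd_eq[OF nth])
      then show ?thesis by (simp add: fun_alg.const)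
      qed
    qed
  qed
qed

text \<open>The cutoff is a profile in \<open>norm (y - x)\<^sup>2\<close>, hence smooth at the centre; rescaling by
  \<open>(r + 1)\<^sup>2 - r\<^sup>2 = 2 * r + 1\<close> makes the gradient bound independent of \<open>r\<close>.\<close>

lemma cutoff_exists:
  "\<exists>C>0. \<forall>(x::real^'n::finite) r. r \<ge> 0 \<longrightarrow> (\<exists>\<eta>. smooth_fun \<eta> \<and>
     (\<forall>y. 0 \<le> \<eta> y \<and> \<eta> y \<le> 1) \<and>
     (\<forall>y. norm (y - x) \<le> r \<longrightarrow> \<eta> y = 0 \<and> grad \<eta> y = 0) \<and>
     (\<forall>y. norm (y - x) \<ge> r + 3/4 \<longrightarrow> \<eta> y = 1) \<and>
     (\<forall>y. norm (y - x) < r + 1 \<longrightarrow> norm (grad \<eta> y) \<le> C))"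
proof -
  define f where "f = flat 1"
  define f' where "f' = flat ([:0, 0, 1:] * (1 - pderiv 1))"
  \<comment> \<open>One of t and 1/2 - t is always positive, so the denominator never vanishes and
    \<open>H\<close> is a smooth step that rises from 0 to 1 on the interval [0, 1/2].\<close>
  define D where "D t = f t + f (1/2 - t)" for t
  define H where "H t = f t / D t" for t
  define H' where "H' t = (f' t * D t - f t * (f' t - f' (1/2 - t))) / (D t * D t)" for t
  have f: "(f has_real_derivative f' t) (at t)" for t
    unfolding f_def f'_def by (rule flat_has_derivative)
  have f_nonneg: "f t \<ge> 0" and f_pos: "t > 0 \<Longrightarrow> f t > 0" and f_0: "t \<le> 0 \<Longrightarrow> f t = 0"
    and f'_0: "t \<le> 0 \<Longrightarrow> f' t = 0" for t
    by (auto simp: f_def f'_def flat_def)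
  have D_pos: "D t > 0" for t
    using f_nonneg[of t] f_nonneg[of "1/2 - t"] f_pos[of t] f_pos[of "1/2 - t"]
    unfolding D_def by (cases "t > 0") (auto intro: add_pos_nonneg add_nonneg_pos)
  have f_refl: "((\<lambda>t. f (1/2 - t)) has_real_derivative - f' (1/2 - t)) (at t)" for t
  proof -
    have "((\<lambda>t. 1/2 - t) has_real_derivative -1) (at t)"
      by (auto intro!: derivative_eq_intros)
    from DERIV_chain2[OF f this] show ?thesis by simp
  qed
  have D: "(D has_real_derivative f' t - f' (1/2 - t)) (at t)" for t
    using DERIV_add[OF f f_refl] by (simp add: D_def[abs_def])
  have H: "(H has_real_derivative H' t) (at t)" for t
    using DERIV_divide[OF f[of t] D[of t]] D_pos[of t] less_imp_neq
    unfolding H_def[abs_def] H'_def by metis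
  have H_0: "t \<le> 0 \<Longrightarrow> H t = 0" "t \<le> 0 \<Longrightarrow> H' t = 0" for t
    by (auto simp: H_def H'_def f_0 f'_0)
  have H_1: "t \<ge> 1/2 \<Longrightarrow> H t = 1" for t
    using D_pos[of t] by (auto simp: H_def D_def f_0)
  have H_range: "0 \<le> H t" "H t \<le> 1" for t
    using D_pos[of t] f_nonneg[of t] f_nonneg[of "1/2 - t"]
    by (auto simp: H_def D_def field_simps)
  have "continuous_on {0..1} H'"
    unfolding H'_def D_def f_def f'_def
    by (intro continuous_intros continuous_on_compose2[OF continuous_on_flat[of UNIV]])
      (use D_pos in \<open>auto simp: D_def f_def less_le\<close>)
  then have "bounded (H' ` {0..1})"
    by (intro compact_imp_bounded compact_continuous_image) auto
  then obtain B where B: "B > 0" "\<And>t. t \<in> {0..1} \<Longrightarrow> \<bar>H' t\<bar> \<le> B"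
    by (auto simp: bounded_pos)
  \<comment> \<open>Only arguments up to 1 matter, because \<open>s y\<close> below stays under 1
    inside the ball of radius r + 1.\<close>
  have B': "\<bar>H' t\<bar> \<le> B" if "t \<le> 1" for t
    using B(1) B(2)[of t] H_0(2)[of t] that by (cases "t \<le> 0") auto
  show ?thesis
  proof (intro exI[of _ "2 * B"] conjI allI impI)
    show "2 * B > 0" using B by simp
    fix x :: "real^'n" and r :: real assume r: "r \<ge> 0"
    define c where "c = 1 / (2 * r + 1)"
    have c: "c > 0" using r by (simp add: c_def)
    \<comment> \<open>Normalised to be 0 on the sphere of radius r and 1 on the sphere of radius r +
      1.\<close>
    define s where "s y = c * (norm (y - x))\<^sup>2 + - (c * r\<^sup>2)" for y
    define \<eta> where "\<eta> y = H (s y)" for y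
    have s_le: "s y \<le> c * (b\<^sup>2 - r\<^sup>2)" if "norm (y - x) \<le> b" for y b
      using that c power_mono[OF that, of 2] by (simp add: s_def algebra_simps)
    have s_ge: "s y \<ge> c * (b\<^sup>2 - r\<^sup>2)" if "norm (y - x) \<ge> b" "b \<ge> 0" for y b
      using that c power_mono[OF that, of 2] by (simp add: s_def algebra_simps)
    have "(s has_derivative (\<lambda>h. (2 * c) *\<^sub>R (y - x) \<bullet> h)) (at y)" for y
      unfolding s_def power2_norm_eq_inner
      by (auto intro!: derivative_eq_intros simp: inner_commute algebra_simps fun_eq_iff)
    from has_derivative_compose[OF this H[unfolded has_field_derivative_def]]
    have "(\<eta> has_derivative (\<lambda>h. (H' (s y) *\<^sub>R (2 * c) *\<^sub>R (y - x)) \<bullet> h)) (at y)" for y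
      by (simp add: \<eta>_def[abs_def] mult.assoc)
    then have grad: "grad \<eta> y = H' (s y) *\<^sub>R (2 * c) *\<^sub>R (y - x)" for y
      by (rule grad_eqI)
    have "smooth_fun (\<lambda>y. f (s y))" "smooth_fun (\<lambda>y. f (1/2 - s y))"
      using smooth_fun_flat_norm[of 1 c x "- (c * r\<^sup>2)"]
        smooth_fun_flat_norm[of 1 "- c" x "c * r\<^sup>2 + 1/2"]
      by (simp_all add: f_def s_def algebra_simps)
    then have "smooth_fun \<eta>"
      unfolding \<eta>_def H_def D_def divide_inverse
      using D_pos by (intro smooth_fun_mult smooth_fun_inverse smooth_fun_add)
        (auto simp: D_def less_le)
    moreover have "\<eta> y = 0 \<and> grad \<eta> y = 0" if "norm (y - x) \<le> r" for y
      using s_le[OF that] by (simp add: \<eta>_def grad H_0)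
    moreover have "\<eta> y = 1" if "norm (y - x) \<ge> r + 3/4" for y
    proof -
      \<comment> \<open>The step is complete already at radius r + 3/4, which leaves room for \<eta>
        - 1 to be compactly supported in the open ball of radius r + 1.\<close>
      have "1/2 \<le> c * ((r + 3/4)\<^sup>2 - r\<^sup>2)"
        using r by (simp add: c_def field_simps power2_eq_square)
      then show ?thesis using s_ge[OF that] r by (auto simp: \<eta>_def intro: H_1)
    qed
    moreover have "norm (grad \<eta> y) \<le> 2 * B" if y: "norm (y - x) < r + 1" for y
    proof -
      have "s y \<le> c * ((r + 1)\<^sup>2 - r\<^sup>2)" by (rule s_le) (use y in simp)
      also have "\<dots> = 1" using r by (simp add: c_def field_simps power2_eq_square)
      finally have "\<bar>H' (s y)\<bar> \<le> B" by (rule B')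
      \<comment> \<open>Here the rescaling removes r: (r + 1) / (2 r + 1) is at most 1.\<close>
      moreover have "c * norm (y - x) \<le> 1"
        using y r by (simp add: c_def field_simps)
      ultimately have "\<bar>H' (s y)\<bar> * (c * norm (y - x)) \<le> B * 1"
        using c B by (intro mult_mono) auto
      then show ?thesis using c by (simp add: grad abs_mult)
    qed
    ultimately show "\<exists>\<eta>. smooth_fun \<eta> \<and>
     (\<forall>y. 0 \<le> \<eta> y \<and> \<eta> y \<le> 1) \<and>
     (\<forall>y. norm (y - x) \<le> r \<longrightarrow> \<eta> y = 0 \<and> grad \<eta> y = 0) \<and>
     (\<forall>y. norm (y - x) \<ge> r + 3/4 \<longrightarrow> \<eta> y = 1) \<and>
     (\<forall>y. norm (y - x) < r + 1 \<longrightarrow> norm (grad \<eta> y) \<le> 2 * B)"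
      using H_range by (intro exI[of _ \<eta>]) (auto simp: \<eta>_def)
  qed
qed

section \<open>Mollification\<close>

text \<open>Continuity is required on the whole space, so the extension by zero is built in and
  integrals over \<open>A\<close> can be moved to the whole space or to a box.\<close>

definition csupp :: "(real^'n::finite) set \<Rightarrow> (real^'n \<Rightarrow> real) \<Rightarrow> bool" where
  "csupp A f \<longleftrightarrow> continuous_on UNIV f \<and> (\<exists>K. compact K \<and> K \<subseteq> A \<and> (\<forall>x. x \<notin> K \<longrightarrow> f x = 0))"

lemma csuppE:
  assumes "csupp A f"
  obtains K where "continuous_on UNIV f" "compact K" "K \<subseteq> A" "\<And>x. x \<notin> K \<Longrightarrow> f x = 0"
  using assms unfolding csupp_def by blast

lemma csupp_subset: "csupp A f \<Longrightarrow> A \<subseteq> B \<Longrightarrow> csupp B f"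
  unfolding csupp_def by blast

lemma csupp_add:
  assumes "csupp A f" "csupp A g"
  shows "csupp A (\<lambda>x. f x + g x)"
proof -
  obtain K L where "compact K" "K \<subseteq> A" "\<And>x. x \<notin> K \<Longrightarrow> f x = 0" "continuous_on UNIV f"
    "compact L" "L \<subseteq> A" "\<And>x. x \<notin> L \<Longrightarrow> g x = 0" "continuous_on UNIV g"
    using assms by (metis csuppE)
  then show ?thesis unfolding csupp_def
    by (intro conjI continuous_intros exI[of _ "K \<union> L"]) (auto intro: compact_Un)
qed

text \<open>The product is continuous on the open set \<open>A\<close> and vanishes on the open
  complement of the support, and these two sets cover the space. Thus \<open>g\<close> may be
  arbitrary outside \<open>A\<close>, as the minimizer is outside its domain.\<close>

lemma csupp_mult:
  assumes f: "csupp A f" and g: "continuous_on A g" and A: "open A"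
  shows "csupp A (\<lambda>x. f x * g x)"
proof -
  obtain K where K: "continuous_on UNIV f" "compact K" "K \<subseteq> A" "\<And>x. x \<notin> K \<Longrightarrow> f x = 0"
    using f by (auto simp: csupp_def)
  have "continuous_on A (\<lambda>x. f x * g x)"
    using g continuous_on_subset[OF K(1)] by (intro continuous_intros) auto
  moreover have "continuous_on (- K) (\<lambda>x. f x * g x) \<longleftrightarrow> continuous_on (- K) (\<lambda>x. 0::real)"
    by (intro continuous_on_cong) (auto simp: K)
  ultimately have "continuous_on (A \<union> - K) (\<lambda>x. f x * g x)"
    using A compact_imp_closed[OF K(2)] by (intro continuous_on_open_Un) (auto simp: open_Compl)
  moreover have "A \<union> - K = UNIV" using K by auto
  ultimately show ?thesis using K unfolding csupp_def by auto
qed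

lemma csupp_test_fun: "test_fun A \<phi> \<Longrightarrow> csupp A \<phi>"
  unfolding test_fun_def csupp_def by (auto intro: smooth_fun_continuous)

lemma csupp_pd_test_fun:
  assumes "test_fun A \<phi>"
  shows "csupp A (pd i \<phi>)"
proof -
  obtain K where K: "smooth_fun \<phi>" "compact K" "K \<subseteq> A" "\<And>x. x \<notin> K \<Longrightarrow> \<phi> x = 0"
    using assms unfolding test_fun_def by blast
  have "pd i \<phi> x = 0" if "x \<notin> K" for x
  proof -
    have "((\<lambda>x. 0) has_derivative (\<lambda>h. 0)) (at x)" by simp
    then have "(\<phi> has_derivative (\<lambda>h. 0)) (at x)"
      by (rule has_derivative_transform_within_open[where s = "- K"])
        (use K that in \<open>auto simp: compact_imp_closed open_Compl\<close>)
    from pd_eq[OF this] show ?thesis by simp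
  qed
  then show ?thesis
    using K smooth_fun_pd smooth_fun_continuous unfolding csupp_def by blast
qed

section \<open>Integrals of compactly supported continuous functions\<close>

lemma csupp_integrable_lebesgue:
  assumes "csupp UNIV f"
  shows "integrable lebesgue f"
proof -
  obtain K where K: "continuous_on UNIV f" "compact K" "\<And>x. x \<notin> K \<Longrightarrow> f x = 0"
    using assms by (auto simp: csupp_def)
  obtain a b where ab: "K \<subseteq> cbox a b"
    using bounded_subset_cbox_symmetric[OF compact_imp_bounded[OF K(2)]] by blast
  have "integrable (lebesgue_on (cbox a b)) f"
    by (intro continuous_imp_integrable continuous_on_subset[OF K(1)]) auto
  then have "integrable lebesgue (\<lambda>x. if x \<in> cbox a b then f x else 0)"
    by (simp add: Lebesgue_Measure.integrable_restrict_UNIV)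
  also have "(\<lambda>x. if x \<in> cbox a b then f x else 0) = f"
    using K ab by (auto simp: fun_eq_iff)
  finally show ?thesis .
qed

lemma csupp_integrable_on: "csupp UNIV f \<Longrightarrow> f integrable_on UNIV"
  using has_integral_integral_lebesgue[OF csupp_integrable_lebesgue] by blast

lemma csupp_integrable_lebesgue_on:
  assumes "csupp UNIV f" "A \<in> sets lebesgue"
  shows "integrable (lebesgue_on A) f"
  using integrable_mult_indicator[OF assms(2) csupp_integrable_lebesgue[OF assms(1)]] assms(2)
  by (subst integrable_restrict_space) auto

lemma csupp_integral_lebesgue_on:
  assumes f: "csupp A f" and A: "A \<in> sets lebesgue"
  shows "integral\<^sup>L (lebesgue_on A) f = integral UNIV f"
proof -
  have f': "csupp UNIV f" using f by (rule csupp_subset) simp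
  obtain K where "K \<subseteq> A" "\<And>x. x \<notin> K \<Longrightarrow> f x = 0" using f by (auto simp: csupp_def)
  then have "(\<lambda>x. if x \<in> A then f x else 0) = f" by (auto simp: fun_eq_iff)
  then have "integral UNIV f = integral A f"
    using Henstock_Kurzweil_Integration.integral_restrict_UNIV[of A f] by simp
  then show ?thesis
    using lebesgue_integral_eq_integral[OF csupp_integrable_lebesgue_on[OF f' A] A] by simp
qed

lemma csupp_integral_cbox:
  assumes "\<And>x. x \<notin> cbox a b \<Longrightarrow> f x = (0::real)"
  shows "integral UNIV f = integral (cbox a b) f"
proof -
  have "(\<lambda>x. if x \<in> cbox a b then f x else 0) = f" using assms by (auto simp: fun_eq_iff)
  then show ?thesis
    using Henstock_Kurzweil_Integration.integral_restrict_UNIV[of "cbox a b" f] by simp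
qed

text \<open>Heine-Cantor on a ball whose radius exceeds that of the support by 1: two points closer
  than 1 either both lie in this ball or both lie off the support.\<close>

lemma csupp_uniformly_continuous:
  assumes "csupp UNIV f"
  shows "uniformly_continuous_on UNIV f"
proof -
  obtain K where K: "continuous_on UNIV f" "compact K" "\<And>x. x \<notin> K \<Longrightarrow> f x = 0"
    using assms by (auto simp: csupp_def)
  obtain a where a: "K \<subseteq> cball 0 a"
    using compact_imp_bounded[OF K(2)] by (auto simp: bounded_iff subset_iff)
  have "uniformly_continuous_on (cball 0 (a + 1)) f"
    by (intro compact_uniformly_continuous continuous_on_subset[OF K(1)]) auto
  note uc = this[unfolded uniformly_continuous_on_def]
  show ?thesis
    unfolding uniformly_continuous_on_def
  proof (intro allI impI)
    fix e :: real assume "e > 0"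
    then obtain d where d: "d > 0" "\<And>x x'. x \<in> cball 0 (a + 1) \<Longrightarrow> x' \<in> cball 0 (a + 1) \<Longrightarrow>
        dist x' x < d \<Longrightarrow> dist (f x') (f x) < e"
      using uc by meson
    have "dist (f x') (f x) < e" if "dist x' x < min d 1" for x x'
    proof (cases "x \<in> K \<or> x' \<in> K")
      case True
      then have "norm x \<le> a \<or> norm x' \<le> a" using a by auto
      moreover have "norm x \<le> norm x' + dist x' x" "norm x' \<le> norm x + dist x' x"
        by norm+
      ultimately show ?thesis using that by (intro d) auto
    next
      case False
      then show ?thesis using K \<open>e > 0\<close> by simp
    qed
    then show "\<exists>d>0. \<forall>x\<in>UNIV. \<forall>x'\<in>UNIV. dist x' x < d \<longrightarrow> dist (f x') (f x) < e"
      using d(1) by (intro exI[of _ "min d 1"]) auto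
  qed
qed

lemma csupp_L2:
  assumes "csupp A f" "A \<in> sets lebesgue"
  shows "L2 A f"
proof -
  have f: "csupp UNIV f" using assms(1) by (rule csupp_subset) simp
  then have "csupp UNIV (\<lambda>x. f x * f x)"
    by (intro csupp_mult) (auto elim: csuppE)
  from csupp_integrable_lebesgue_on[OF this assms(2)] csupp_integrable_lebesgue_on[OF f assms(2)]
  show ?thesis unfolding L2_def by (simp add: power2_eq_square)
qed

section \<open>Convolution with smooth kernels\<close>

definition conv :: "(real^'n::finite \<Rightarrow> real) \<Rightarrow> (real^'n \<Rightarrow> real) \<Rightarrow> real^'n \<Rightarrow> real" where
  "conv \<rho> h x = integral UNIV (\<lambda>y. \<rho> (x - y) * h y)"

text \<open>Differentiation under the integral sign. The support of \<open>h\<close> confines the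
  integral to a box, where the derivative of the integrand is jointly continuous; it falls on the
  kernel alone.\<close>

lemma conv_derivative:
  fixes \<rho> h :: "real^'n::finite \<Rightarrow> real"
  assumes \<rho>: "smooth_fun \<rho>" and h: "csupp UNIV h"
  shows "conv \<rho> h differentiable (at x)" "pd i (conv \<rho> h) x = conv (pd i \<rho>) h x"
proof -
  obtain K where K: "continuous_on UNIV h" "compact K" "\<And>x. x \<notin> K \<Longrightarrow> h x = 0"
    using h by (auto simp: csupp_def)
  obtain a b where ab: "K \<subseteq> cbox a b"
    using bounded_subset_cbox_symmetric[OF compact_imp_bounded[OF K(2)]] by blast
  have conv: "conv \<sigma> h x = integral (cbox a b) (\<lambda>y. \<sigma> (x - y) * h y)" for \<sigma> x
    unfolding conv_def by (intro csupp_integral_cbox) (use K ab in auto)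
  have cont: "continuous_on S (\<lambda>z. \<sigma> (p z - q z))"
    if "smooth_fun \<sigma>" "continuous_on S p" "continuous_on S q"
    for \<sigma> :: "real^'n \<Rightarrow> real" and S :: "'z::topological_space set" and p q :: "'z \<Rightarrow> real^'n"
    by (rule continuous_on_compose2[OF smooth_fun_continuous[OF that(1), of UNIV]])
      (use that in \<open>auto intro!: continuous_intros\<close>)
  \<comment> \<open>The derivative is packaged as a bounded linear functional because the Leibniz
    rule integrates operator-valued functions.\<close>
  define fx where "fx x t = blinfun_inner_right (h t *\<^sub>R grad \<rho> (x - t))" for x t
  have cfx: "continuous_on S (\<lambda>z. fx (p z) (q z))"
    if "continuous_on S p" "continuous_on S q"
    for S :: "'z::topological_space set" and p q
    unfolding fx_def using that
    by (intro bounded_linear.continuous_on[OF bounded_linear_blinfun_inner_right]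
        continuous_intros continuous_on_compose2[OF K(1)]
        continuous_on_compose2[OF continuous_grad[OF \<rho>, of UNIV]]) auto
  have der: "(conv \<rho> h has_derivative integral (cbox a b) (fx x)) (at x)"
    unfolding conv[abs_def]
  proof (rule leibniz_rule[where U = UNIV and fx = fx])
    fix x t :: "real^'n"
    have diff: "((\<lambda>x. x - t) has_derivative (\<lambda>h. h)) (at x)"
      by (auto intro!: derivative_eq_intros)
    have "blinfun_apply (fx x t) = (\<lambda>k. (grad \<rho> (x - t) \<bullet> k) * h t)"
      by (auto simp: fx_def fun_eq_iff)
    with has_derivative_mult_left[OF has_derivative_compose[OF diff
          smooth_fun_has_derivative[OF \<rho>, of "x - t"]], of "h t"]
    show "((\<lambda>x. \<rho> (x - t) * h t) has_derivative blinfun_apply (fx x t)) (at x)"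
      by simp
    show "(\<lambda>y. \<rho> (x - y) * h y) integrable_on cbox a b"
      by (intro integrable_continuous continuous_intros cont \<rho> continuous_on_subset[OF K(1)]) auto
  next
    show "continuous_on (UNIV \<times> cbox a b) (\<lambda>(x, t). fx x t)"
      unfolding case_prod_beta by (intro cfx continuous_intros)
  qed auto
  then show "conv \<rho> h differentiable (at x)" by (auto simp: differentiable_def)
  have "fx x integrable_on cbox a b"
    by (intro integrable_continuous cfx continuous_intros)
  then show "pd i (conv \<rho> h) x = conv (pd i \<rho>) h x"
    unfolding pd_eq[OF der] by (simp add: blinfun_apply_integral conv fx_def inner_axis mult.commute)
qed

text \<open>With \<open>h\<close> fixed and the smooth kernel varying, the convolutions form a class
  closed under \<open>pd\<close>.\<close>

lemma smooth_fun_conv: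
  assumes "smooth_fun \<rho>" "csupp UNIV h"
  shows "smooth_fun (conv \<rho> h)"
proof (rule smooth_fun_coinduct[where S = "{conv \<rho> h | \<rho>. smooth_fun \<rho>}"])
  fix f assume "f \<in> {conv \<rho> h | \<rho>. smooth_fun \<rho>}"
  then obtain \<sigma> where \<sigma>: "smooth_fun \<sigma>" and f: "f = conv \<sigma> h" by blast
  show "f differentiable (at x)" for x
    unfolding f using conv_derivative(1)[OF \<sigma> assms(2)] .
  have "pd i f = conv (pd i \<sigma>) h" for i
    unfolding f by (intro ext conv_derivative \<sigma> assms(2))
  then show "pd i f \<in> {conv \<rho> h | \<rho>. smooth_fun \<rho>}" for i
    using smooth_fun_pd[OF \<sigma>] by blast
qed (use assms in blast)

text \<open>The bump exp(-1 / (\<delta>^2 - |z|^2)), supported in the ball of radius \<delta> and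
  divided by its integral. The normalisation is stated for \<open>\<rho> (x - y)\<close>, the form
  in which the kernel enters \<open>conv\<close>.\<close>

lemma mollifier_exists:
  fixes \<delta> :: real
  assumes "\<delta> > 0"
  obtains \<rho> :: "real^'n::finite \<Rightarrow> real" where "smooth_fun \<rho>" "\<And>z. \<rho> z \<ge> 0"
    "\<And>z. norm z \<ge> \<delta> \<Longrightarrow> \<rho> z = 0" "\<And>x. ((\<lambda>y. \<rho> (x - y)) has_integral 1) UNIV"
proof -
  define f where "f z = flat 1 ((- 1) * (norm (z - 0))\<^sup>2 + \<delta>\<^sup>2)" for z :: "real^'n"
  have f: "smooth_fun f" unfolding f_def by (rule smooth_fun_flat_norm)
  have f_nonneg: "f z \<ge> 0" for z by (simp add: f_def flat_def)
  have f_0: "f z = 0" if "norm z \<ge> \<delta>" for z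
    using power_mono[OF that, of 2] assms by (auto simp: f_def flat_def not_less)
  have f_pos: "f 0 > 0" using assms by (simp add: f_def flat_def)
  obtain b :: "real^'n" where b: "cball 0 \<delta> \<subseteq> cbox (- b) b"
    using bounded_subset_cbox_symmetric[OF bounded_cball] by blast
  have f_b: "f z = 0" if "z \<notin> cbox (- b) b" for z
    using that b f_0[of z] by (force simp: subset_iff)
  define c where "c = integral (cbox (- b) b) f"
  have int: "(f has_integral c) (cbox (- b) b)"
    unfolding c_def by (intro integrable_integral integrable_continuous smooth_fun_continuous f)
  have "c \<ge> 0" using int f_nonneg by (rule has_integral_nonneg)
  \<comment> \<open>A continuous nonnegative function with zero integral over the box would vanish
    at the origin, where the bump is positive.\<close>
  moreover have "c \<noteq> 0"
  proof
    assume "c = 0"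
    moreover have "0 \<in> cbox (- b) b" using b assms by (auto simp: subset_iff)
    moreover have "box (- b) b \<noteq> {}"
    proof -
      have "0 < b $ i" for i
        using subsetD[OF b, of "axis i \<delta>"] assms
        by (auto simp: mem_box_cart norm_eq_sqrt_inner inner_axis dest: spec[of _ i])
      then have "0 \<in> box (- b) b" by (simp add: mem_box_cart)
      then show ?thesis by blast
    qed
    ultimately have "f 0 = 0"
      using has_integral_0_cbox_imp_0[OF smooth_fun_continuous[OF f] f_nonneg] int by blast
    then show False using f_pos by simp
  qed
  ultimately have c: "c > 0" by simp
  have "((\<lambda>y. f (x - y)) has_integral c) UNIV" for x
  proof -
    have "((\<lambda>y. f ((- 1) *\<^sub>R y + x)) has_integral c)
        ((\<lambda>y. (1 / (- 1)) *\<^sub>R y + - ((1 / (- 1)) *\<^sub>R x)) ` cbox (- b) b)" (is "(_ has_integral _) ?S")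
      using has_integral_affinity[OF int, of "- 1" x] by simp
    then have "((\<lambda>y. f (x - y)) has_integral c) ?S" by (simp add: add.commute)
    then show ?thesis
    proof (rule has_integral_on_superset)
      fix y assume "y \<notin> ?S"
      then have "x - y \<notin> cbox (- b) b" by (force simp: image_iff)
      then show "f (x - y) = 0" by (rule f_b)
    qed auto
  qed
  from has_integral_mult_right[OF this, of "inverse c"] c
  have "((\<lambda>y. inverse c * f (x - y)) has_integral 1) UNIV" for x by simp
  then show ?thesis
    using f f_nonneg f_0 c by (intro that[of "\<lambda>z. inverse c * f z"] smooth_fun_mult smooth_fun_const) auto
qed

text \<open>The kernel has mass 1, so the error is a weighted mean of \<open>h y - h x\<close>, and
  only points \<open>y\<close> within \<delta> of \<open>x\<close> contribute.\<close>

lemma conv_approx: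
  assumes h: "csupp UNIV h" and \<rho>: "smooth_fun \<rho>" "\<And>z. \<rho> z \<ge> 0"
    "\<And>z. norm z \<ge> \<delta> \<Longrightarrow> \<rho> z = 0" "\<And>x. ((\<lambda>y. \<rho> (x - y)) has_integral 1) UNIV"
    and e: "\<And>x y. norm (x - y) < \<delta> \<Longrightarrow> \<bar>h y - h x\<bar> \<le> e"
  shows "\<bar>conv \<rho> h x - h x\<bar> \<le> e"
proof -
  have "csupp UNIV (\<lambda>y. h y * \<rho> (x - y))"
    by (intro csupp_mult[OF h] smooth_fun_continuous smooth_fun_reflect \<rho>) auto
  from integrable_integral[OF csupp_integrable_on[OF this]]
  have "((\<lambda>y. \<rho> (x - y) * h y) has_integral conv \<rho> h x) UNIV"
    unfolding conv_def by (simp add: mult.commute)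
  from has_integral_diff[OF this has_integral_mult_left[OF \<rho>(4)[of x], of "h x"]]
  have 1: "((\<lambda>y. \<rho> (x - y) * (h y - h x)) has_integral conv \<rho> h x - h x) UNIV"
    by (simp add: algebra_simps)
  have 2: "((\<lambda>y. \<rho> (x - y) * e) has_integral e) UNIV"
    using has_integral_mult_left[OF \<rho>(4)[of x], of e] by simp
  have "norm (\<rho> (x - y) * (h y - h x)) \<le> \<rho> (x - y) * e" for y
  proof (cases "norm (x - y) < \<delta>")
    case True
    then show ?thesis using \<rho>(2)[of "x - y"] e[of x y] by (auto simp: abs_mult intro: mult_left_mono)
  next
    case False
    then show ?thesis using \<rho>(3)[of "x - y"] by simp
  qed
  then have "norm (integral UNIV (\<lambda>y. \<rho> (x - y) * (h y - h x))) \<le> integral UNIV (\<lambda>y. \<rho> (x - y) * e)"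
    using 1 2 by (intro integral_norm_bound_integral) blast+
  then show ?thesis unfolding integral_unique[OF 1] integral_unique[OF 2] by simp
qed

lemma test_fun_mult_smooth:
  "test_fun A \<zeta> \<Longrightarrow> smooth_fun \<phi> \<Longrightarrow> test_fun A (\<lambda>x. \<zeta> x * \<phi> x)"
  unfolding test_fun_def by (auto intro!: smooth_fun_mult)

lemma csupp_approx:
  assumes h: "csupp UNIV h" and "e > 0"
  shows "\<exists>\<delta>>0. \<forall>x y. norm (x - y) < \<delta> \<longrightarrow> \<bar>h y - h x\<bar> \<le> e"
proof -
  obtain \<delta> where "\<delta> > 0" "\<forall>x x'. dist x' x < \<delta> \<longrightarrow> dist (h x') (h x) < e"
    using csupp_uniformly_continuous[OF h] \<open>e > 0\<close> unfolding uniformly_continuous_on_def by auto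
  then show ?thesis
    by (intro exI[of _ \<delta>]) (auto simp: dist_norm norm_minus_commute intro: less_imp_le)
qed

text \<open>The convolution vanishes off the sum of \<open>K\<close> and the closed \<delta>-ball.
  That sum stays in \<open>A\<close> once \<delta> is below a positive lower bound \<open>d\<close>
  for the distance from \<open>K\<close> to the complement of \<open>A\<close>.\<close>

lemma test_fun_conv:
  assumes A: "open A" and h: "csupp A h"
  obtains d where "d > 0"
    "\<And>\<rho> \<delta>. smooth_fun \<rho> \<Longrightarrow> \<delta> < d \<Longrightarrow> (\<And>z. norm z \<ge> \<delta> \<Longrightarrow> \<rho> z = 0) \<Longrightarrow> test_fun A (conv \<rho> h)"
proof -
  obtain K where K: "compact K" "K \<subseteq> A" "\<And>x. x \<notin> K \<Longrightarrow> h x = 0"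
    using h by (auto simp: csupp_def)
  obtain d where d: "d > 0" "\<And>x y. x \<in> K \<Longrightarrow> y \<in> - A \<Longrightarrow> d \<le> dist x y"
    using separate_compact_closed[of K "- A"] K A by (metis Compl_disjoint closed_Compl disjoint_eq_subset_Compl double_complement inf_commute)
  have "test_fun A (conv \<rho> h)"
    if \<rho>: "smooth_fun \<rho>" "\<delta> < d" "\<And>z. norm z \<ge> \<delta> \<Longrightarrow> \<rho> z = 0" for \<rho> \<delta>
    unfolding test_fun_def
  proof (intro conjI exI allI impI)
    show "smooth_fun (conv \<rho> h)"
      using \<rho> csupp_subset[OF h] by (intro smooth_fun_conv) auto
    let ?K = "{x + y | x y. x \<in> K \<and> y \<in> cball 0 \<delta>}"
    show "compact ?K" by (intro compact_sums K compact_cball)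
    have "x + y \<in> A" if "x \<in> K" "norm y \<le> \<delta>" for x y
      using d(2)[of x "x + y"] that \<rho>(2) by (auto simp: dist_norm)
    then show "?K \<subseteq> A" by auto
    fix x assume x: "x \<notin> ?K"
    have "\<rho> (x - y) * h y = 0" for y
    proof (cases "y \<in> K")
      case True
      moreover have "x = y + (x - y)" by simp
      ultimately have "x - y \<notin> cball 0 \<delta>" using x by blast
      then show ?thesis using \<rho>(3) by simp
    qed (simp add: K)
    then have "(\<lambda>y. \<rho> (x - y) * h y) = (\<lambda>y. 0)" by blast
    then show "conv \<rho> h x = 0" by (simp add: conv_def)
  qed
  with d(1) show ?thesis by (rule that)
qed

section \<open>Admissible perturbations\<close>

lemma integral_lebesgue_on_bounds:
  assumes A: "A \<in> lmeasurable" and c: "0 \<le> c"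
    and f: "\<And>x. x \<in> A \<Longrightarrow> 0 \<le> f x" "\<And>x. x \<in> A \<Longrightarrow> f x \<le> (c::real)"
  shows "0 \<le> integral\<^sup>L (lebesgue_on A) f" "integral\<^sup>L (lebesgue_on A) f \<le> c * measure lebesgue A"
proof -
  show "0 \<le> integral\<^sup>L (lebesgue_on A) f"
    by (rule Bochner_Integration.integral_nonneg) (use f A in auto)
  show "integral\<^sup>L (lebesgue_on A) f \<le> c * measure lebesgue A"
  proof (cases "integrable (lebesgue_on A) f")
    case True
    have "integrable (lebesgue_on A) (\<lambda>x. c)" by (rule finite_measure.integrable_const[OF finite_measure_lebesgue_on[OF A]])
    with True have "integral\<^sup>L (lebesgue_on A) f \<le> integral\<^sup>L (lebesgue_on A) (\<lambda>x. c)"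
      using f A by (intro Bochner_Integration.integral_mono) auto
    also have "\<dots> = c * measure lebesgue A"
      using A by (simp add: measure_restrict_space fmeasurableD)
    finally show ?thesis .
  next
    \<comment> \<open>A non-integrable function has Bochner integral 0 by convention, so the bound
      holds here too.\<close>
    case False
    then show ?thesis using c by (simp add: not_integrable_integral_eq)
  qed
qed

text \<open>The product rule supplies the weak gradient. Mollifying the product yields test
  functions that converge uniformly together with their gradients, and on a set of finite measure
  uniform convergence implies convergence in \<open>L2\<close>.\<close>

lemma W12_0_test_fun_mult:
  fixes A :: "(real^'n::finite) set"
  assumes A: "open A" "bounded A" and \<zeta>: "test_fun A \<zeta>" and W12: "W12 A u Du"
    and u: "continuous_on A u" and Du: "continuous_on A Du"
  shows "W12_0 A (\<lambda>x. \<zeta> x * u x) (\<lambda>x. \<zeta> x *\<^sub>R Du x + u x *\<^sub>R grad \<zeta> x)"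
proof -
  define v where "v x = \<zeta> x * u x" for x
  define g where "g x = \<zeta> x *\<^sub>R Du x + u x *\<^sub>R grad \<zeta> x" for x
  have g_nth: "g x $ i = \<zeta> x * Du x $ i + pd i \<zeta> x * u x" for x i
    by (simp add: g_def mult.commute)
  have lm: "A \<in> lmeasurable" using A by (simp add: bounded_set_imp_lmeasurable)
  then have meas: "A \<in> sets lebesgue" by auto
  have \<zeta>_smooth: "smooth_fun \<zeta>" using \<zeta> by (simp add: test_fun_def)
  have Du_nth: "continuous_on A (\<lambda>x. Du x $ i)" for i
    using Du by (intro continuous_intros)
  have cv: "csupp A v" unfolding v_def by (intro csupp_mult csupp_test_fun \<zeta> u A)
  have c1: "csupp A (\<lambda>x. \<zeta> x * Du x $ i)" and c2: "csupp A (\<lambda>x. pd i \<zeta> x * u x)" for i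
    by (intro csupp_mult csupp_test_fun csupp_pd_test_fun \<zeta> u A Du_nth)+
  have cg: "csupp A (\<lambda>x. g x $ i)" for i
    unfolding g_nth by (intro csupp_add c1 c2)
  have cv': "csupp UNIV v" and cg': "csupp UNIV (\<lambda>x. g x $ i)" for i
    using csupp_subset[OF cv] csupp_subset[OF cg] by auto
  have int: "integrable (lebesgue_on A) f" if "csupp A f" for f
    using csupp_subset[OF that] meas by (intro csupp_integrable_lebesgue_on) auto
  \<comment> \<open>Valid for every smooth \<phi>, compactly supported or not: the weak derivative
    of \<open>u\<close> is tested with \<zeta> \<phi>, and \<zeta> carries the compact
    support.\<close>
  have parts: "integral\<^sup>L (lebesgue_on A) (\<lambda>x. v x * pd i \<phi> x) =
      - integral\<^sup>L (lebesgue_on A) (\<lambda>x. g x $ i * \<phi> x)" if \<phi>: "smooth_fun \<phi>" for \<phi> i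
  proof -
    have \<phi>_cont: "continuous_on A \<phi>" "continuous_on A (pd i \<phi>)"
      by (intro smooth_fun_continuous smooth_fun_pd \<phi>)+
    have i1: "integrable (lebesgue_on A) (\<lambda>x. v x * pd i \<phi> x)"
      and i2: "integrable (lebesgue_on A) (\<lambda>x. pd i \<zeta> x * u x * \<phi> x)"
      and i3: "integrable (lebesgue_on A) (\<lambda>x. \<zeta> x * Du x $ i * \<phi> x)"
      by (intro int csupp_mult cv c1 c2 A \<phi>_cont)+
    have "integral\<^sup>L (lebesgue_on A) (\<lambda>x. v x * pd i \<phi> x)
        + integral\<^sup>L (lebesgue_on A) (\<lambda>x. pd i \<zeta> x * u x * \<phi> x)
        = integral\<^sup>L (lebesgue_on A) (\<lambda>x. u x * pd i (\<lambda>x. \<zeta> x * \<phi> x) x)"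
      using Bochner_Integration.integral_add[OF i1 i2]
      by (simp add: pd_mult smooth_fun_differentiable \<zeta>_smooth \<phi> v_def algebra_simps)
    also have "\<dots> = - integral\<^sup>L (lebesgue_on A) (\<lambda>x. Du x $ i * (\<zeta> x * \<phi> x))"
      using W12 test_fun_mult_smooth[OF \<zeta> \<phi>] unfolding W12_def by blast
    finally show ?thesis
      using Bochner_Integration.integral_add[OF i3 i2] by (simp add: g_nth algebra_simps)
  qed
  have "W12 A v g"
    unfolding W12_def using parts csupp_L2[OF cv meas] csupp_L2[OF cg meas]
    by (auto simp: test_fun_def)
  \<comment> \<open>The weak derivative of \<open>u\<close> is tested with \<open>y \<mapsto> \<zeta> y * \<rho> (x - y)\<close>, which is compactly
    supported in \<open>A\<close> even when \<open>\<rho> (x - y)\<close> is not.\<close>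
  have pd_conv: "pd i (conv \<rho> v) x = conv \<rho> (\<lambda>x. g x $ i) x" if \<rho>: "smooth_fun \<rho>" for \<rho> x i
  proof -
    have "smooth_fun (\<lambda>y. \<rho> (x - y))" by (rule smooth_fun_reflect[OF \<rho>])
    note s = this smooth_fun_reflect[OF smooth_fun_pd[OF \<rho>], of i x]
    have "csupp A (\<lambda>y. v y * pd i \<rho> (x - y))" "csupp A (\<lambda>y. g y $ i * \<rho> (x - y))"
      by (intro csupp_mult cv cg A smooth_fun_continuous s)+
    then show ?thesis
      using parts[OF s(1), of i]
      by (simp add: csupp_integral_lebesgue_on meas pd_reflect[OF \<rho>] conv_derivative(2)[OF \<rho> cv']
          conv_def mult.commute)
  qed
  have approx: "\<exists>\<phi>. test_fun A \<phi> \<and> (\<forall>x. \<bar>\<phi> x - v x\<bar> \<le> e) \<and> (\<forall>x i. \<bar>pd i \<phi> x - g x $ i\<bar> \<le> e)"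
    if e: "e > 0" for e
  proof -
    obtain d where d: "d > 0" "\<And>\<rho> \<delta>. smooth_fun \<rho> \<Longrightarrow> \<delta> < d \<Longrightarrow>
        (\<And>z. norm z \<ge> \<delta> \<Longrightarrow> \<rho> z = 0) \<Longrightarrow> test_fun A (conv \<rho> v)"
      using test_fun_conv[OF A(1) cv] by blast
    obtain d' where d': "d' > 0" "\<And>x y. norm (x - y) < d' \<Longrightarrow> \<bar>v y - v x\<bar> \<le> e"
      using csupp_approx[OF cv' e] by blast
    obtain di where di: "\<And>i. di i > 0" "\<And>i x y. norm (x - y) < di i \<Longrightarrow> \<bar>g y $ i - g x $ i\<bar> \<le> e"
      using csupp_approx[OF cg' e] by metis
    \<comment> \<open>A single radius serves the function and all components of its gradient, since
      there are finitely many directions; halving \<open>d\<close> gives the strict inequality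
      \<delta> < d.\<close>
    define \<delta> where "\<delta> = min (d / 2) (min d' (Min (range di)))"
    have \<delta>: "\<delta> > 0" "\<delta> < d" "\<delta> \<le> d'" "\<delta> \<le> di i" for i
      using d(1) d'(1) di(1) by (auto simp: \<delta>_def min_le_iff_disj)
    obtain \<rho> :: "real^'n \<Rightarrow> real" where \<rho>: "smooth_fun \<rho>" "\<And>z. \<rho> z \<ge> 0"
      "\<And>z. norm z \<ge> \<delta> \<Longrightarrow> \<rho> z = 0" "\<And>x. ((\<lambda>y. \<rho> (x - y)) has_integral 1) UNIV"
      using mollifier_exists[OF \<delta>(1)] by blast
    show ?thesis
    proof (intro exI conjI allI)
      show "test_fun A (conv \<rho> v)" by (rule d(2)[OF \<rho>(1) \<delta>(2) \<rho>(3)])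
      show "\<bar>conv \<rho> v x - v x\<bar> \<le> e" for x
        by (rule conv_approx[OF cv' \<rho>]) (use d'(2) \<delta>(3) in force)+
      show "\<bar>pd i (conv \<rho> v) x - g x $ i\<bar> \<le> e" for x i
        unfolding pd_conv[OF \<rho>(1)]
        by (rule conv_approx[OF cg' \<rho>]) (use di(2)[of _ _ i] \<delta>(4)[of i] in force)+
    qed
  qed
  have "\<forall>k. \<exists>\<phi>. test_fun A \<phi> \<and> (\<forall>x. \<bar>\<phi> x - v x\<bar> \<le> inverse (real (Suc k))) \<and>
      (\<forall>x i. \<bar>pd i \<phi> x - g x $ i\<bar> \<le> inverse (real (Suc k)))"
    by (intro allI approx) simp
  then obtain \<phi>s where \<phi>s: "\<And>k. test_fun A (\<phi>s k)"
    "\<And>k x. \<bar>\<phi>s k x - v x\<bar> \<le> inverse (real (Suc k))"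
    "\<And>k x i. \<bar>pd i (\<phi>s k) x - g x $ i\<bar> \<le> inverse (real (Suc k))"
    by metis
  have lim: "(\<lambda>k. integral\<^sup>L (lebesgue_on A) (f k)) \<longlonglongrightarrow> 0"
    if f: "\<And>k x. 0 \<le> f k x" "\<And>k x. f k x \<le> C * (inverse (real (Suc k)))\<^sup>2" for f C
  proof (rule tendsto_sandwich)
    have c: "0 \<le> C * (inverse (real (Suc k)))\<^sup>2" for k
      using f[of k] order_trans by blast
    show "\<forall>\<^sub>F k in sequentially. 0 \<le> integral\<^sup>L (lebesgue_on A) (f k)"
      using integral_lebesgue_on_bounds(1)[OF lm c f] by simp
    show "\<forall>\<^sub>F k in sequentially. integral\<^sup>L (lebesgue_on A) (f k)
        \<le> C * (inverse (real (Suc k)))\<^sup>2 * measure lebesgue A"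
      using integral_lebesgue_on_bounds(2)[OF lm c f] by simp
    have "(\<lambda>k. C * (inverse (real (Suc k)))\<^sup>2 * measure lebesgue A) \<longlonglongrightarrow> C * 0\<^sup>2 * measure lebesgue A"
      by (intro tendsto_intros LIMSEQ_inverse_real_of_nat)
    then show "(\<lambda>k. C * (inverse (real (Suc k)))\<^sup>2 * measure lebesgue A) \<longlonglongrightarrow> 0" by simp
  qed simp
  have sq: "y\<^sup>2 \<le> z\<^sup>2" if "\<bar>y\<bar> \<le> z" for y z :: real
    using power_mono[OF that, of 2] by simp
  have "(\<lambda>k. integral\<^sup>L (lebesgue_on A) (\<lambda>x. (\<phi>s k x - v x)\<^sup>2)) \<longlonglongrightarrow> 0"
    by (rule lim[where C = 1]) (use sq[OF \<phi>s(2)] in auto)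
  moreover have "(\<lambda>k. integral\<^sup>L (lebesgue_on A) (\<lambda>x. (norm (grad (\<phi>s k) x - g x))\<^sup>2)) \<longlonglongrightarrow> 0"
  proof (rule lim[where C = "CARD('n)"])
    fix k x
    have "(norm (grad (\<phi>s k) x - g x))\<^sup>2 = (\<Sum>i\<in>UNIV. (pd i (\<phi>s k) x - g x $ i)\<^sup>2)"
      unfolding power2_norm_eq_inner by (simp add: inner_vec_def power2_eq_square)
    also have "\<dots> \<le> (\<Sum>i\<in>(UNIV::'n set). (inverse (real (Suc k)))\<^sup>2)"
      by (intro sum_mono sq \<phi>s)
    finally show "(norm (grad (\<phi>s k) x - g x))\<^sup>2 \<le> CARD('n) * (inverse (real (Suc k)))\<^sup>2" by simp
  qed simp
  ultimately have "W12_0 A v g"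
    unfolding W12_0_def using \<open>W12 A v g\<close> \<phi>s(1) by blast
  then show ?thesis unfolding v_def[abs_def] g_def[abs_def] .
qed

section \<open>Balls are Lipschitz domains\<close>

text \<open>Rotate so that the inward radius x - p points along axis j. Near p the sphere is then
  the graph of r - sqrt(r^2 - |q|^2), with q the projection orthogonal to that axis.\<close>

lemma lipschitz_domain_ball:
  fixes x :: "real^'n::finite"
  assumes "r > 0"
  shows "lipschitz_domain (ball x r)"
  unfolding lipschitz_domain_def
proof (intro conjI ballI)
  show "open (ball x r)" "connected (ball x r)" "ball x r \<noteq> {}" using assms by auto
  fix p assume "p \<in> frontier (ball x r)"
  then have xp: "norm (x - p) = r" using assms by (simp add: dist_norm)
  fix j :: 'n
  define e :: "real^'n" where "e = axis j 1"
  obtain T where T: "orthogonal_transformation T" "T (x - p) = r *\<^sub>R e"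
    using orthogonal_transformation_exists[of "x - p" "r *\<^sub>R e"] xp assms by (auto simp: e_def norm_axis_1)
  interpret T: linear T using T(1) by (rule orthogonal_transformation_linear)
  define q where "q z = z - (z $ j) *\<^sub>R e" for z :: "real^'n"
  have q_sq: "(norm z)\<^sup>2 = (norm (q z))\<^sup>2 + (z $ j)\<^sup>2" for z
  proof -
    have "z \<bullet> e = z $ j" "e \<bullet> z = z $ j" "e \<bullet> e = 1"
      by (simp_all add: e_def inner_axis inner_axis')
    then show ?thesis
      unfolding power2_norm_eq_inner q_def
      by (simp add: inner_diff_left inner_diff_right power2_eq_square)
  qed
  have q_le: "norm (q z) \<le> norm z" for z
    by (rule power2_le_imp_le) (simp_all add: q_sq[of z])
  \<comment> \<open>Truncating |q| at r/2 keeps the square root away from its singularity, so that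
    \<gamma> is Lipschitz on the whole space; within distance r/2 of p the truncation has no
    effect.\<close>
  define s where "s z = min (norm (q z)) (r / 2)" for z
  define \<gamma> where "\<gamma> z = r - sqrt (r\<^sup>2 - (s z)\<^sup>2)" for z
  have s: "0 \<le> s z" "s z \<le> r / 2" for z using assms by (auto simp: s_def)
  have "\<bar>s y - s z\<bar> \<le> norm (y - z)" for y z
  proof -
    have "q y - q z = q (y - z)" by (simp add: q_def algebra_simps)
    then have "\<bar>norm (q y) - norm (q z)\<bar> \<le> norm (q (y - z))"
      using norm_triangle_ineq3[of "q y" "q z"] by simp
    also have "\<dots> \<le> norm (y - z)" by (rule q_le)
    finally show ?thesis unfolding s_def by linarith
  qed
  note s_lip = this
  have root: "sqrt (r\<^sup>2 - (s z)\<^sup>2) \<ge> r / 2" for z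
  proof (rule real_le_rsqrt)
    have "(s z)\<^sup>2 \<le> (r / 2)\<^sup>2" using s by (intro power_mono)
    moreover have "(r / 2)\<^sup>2 \<le> r\<^sup>2 / 2" by (simp add: power2_eq_square)
    moreover have "(r / 2)\<^sup>2 = r\<^sup>2 / 4" by (simp add: power2_eq_square)
    ultimately show "(r / 2)\<^sup>2 \<le> r\<^sup>2 - (s z)\<^sup>2" by linarith
  qed
  have rad: "r\<^sup>2 - (s z)\<^sup>2 \<ge> 0" for z
    using power_mono[of "s z" r 2] s[of z] assms by simp
  have "1-lipschitz_on UNIV \<gamma>"
  proof (rule lipschitz_onI)
    fix y z
    define a b where "a = sqrt (r\<^sup>2 - (s y)\<^sup>2)" and "b = sqrt (r\<^sup>2 - (s z)\<^sup>2)"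
    have ab: "a \<ge> r / 2" "b \<ge> r / 2" using root by (auto simp: a_def b_def)
    \<comment> \<open>Both roots are at least r/2, so a + b \<ge> r, while the two truncated lengths
      add up to at most r. Comparing differences of squares gives the Lipschitz constant 1.\<close>
    have "\<bar>a - b\<bar> * r \<le> \<bar>a - b\<bar> * \<bar>a + b\<bar>"
      using ab by (intro mult_left_mono) auto
    also have "\<dots> = \<bar>a\<^sup>2 - b\<^sup>2\<bar>" by (simp add: power2_eq_square abs_mult[symmetric] algebra_simps)
    also have "\<dots> = \<bar>(s y)\<^sup>2 - (s z)\<^sup>2\<bar>" using rad by (simp add: a_def b_def abs_minus_commute)
    also have "\<dots> = \<bar>s y + s z\<bar> * \<bar>s y - s z\<bar>"
      by (simp add: power2_eq_square abs_mult[symmetric] algebra_simps)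
    also have "\<dots> \<le> r * norm (y - z)"
      using s[of y] s[of z] assms by (intro mult_mono s_lip) auto
    finally have "\<bar>a - b\<bar> \<le> norm (y - z)" using assms by (simp add: mult.commute)
    then show "dist (\<gamma> y) (\<gamma> z) \<le> 1 * dist y z"
      by (simp add: \<gamma>_def a_def b_def dist_norm abs_minus_commute)
  qed simp
  moreover have "\<gamma> y = \<gamma> z" if "\<forall>i. i \<noteq> j \<longrightarrow> y $ i = z $ i" for y z
  proof -
    have "q y = q z" using that by (auto simp: q_def e_def vec_eq_iff axis_def)
    then show ?thesis by (simp add: \<gamma>_def s_def)
  qed
  moreover have "ball x r \<inter> ball p (r / 2) = {y \<in> ball p (r / 2). T (y - p) $ j > \<gamma> (T (y - p))}"
  proof -
    have "norm (y - x) < r \<longleftrightarrow> T (y - p) $ j > \<gamma> (T (y - p))" if y: "norm (y - p) < r / 2" for y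
    proof -
      define z where "z = T (y - p)"
      have z: "norm z < r / 2"
        using y T(1) by (simp add: z_def orthogonal_transformation_norm)
      then have sz: "s z = norm (q z)" using q_le[of z] by (simp add: s_def)
      have zj: "\<bar>z $ j\<bar> < r / 2" using component_le_norm_cart[of z j] z by simp
      have "norm (y - x) = norm (T ((y - p) - (x - p)))"
        using T(1) by (simp add: orthogonal_transformation_norm)
      also have "\<dots> = norm (z - r *\<^sub>R e)" by (subst T.diff) (simp only: z_def T(2))
      finally have "norm (y - x) < r \<longleftrightarrow> (norm (z - r *\<^sub>R e))\<^sup>2 < r\<^sup>2"
        using assms by (auto intro: power2_less_imp_less power_strict_mono)
      also have "(norm (z - r *\<^sub>R e))\<^sup>2 = (s z)\<^sup>2 + (z $ j - r)\<^sup>2"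
      proof -
        have "q (z - r *\<^sub>R e) = q z" by (simp add: q_def e_def vec_eq_iff axis_def)
        then show ?thesis using q_sq[of "z - r *\<^sub>R e"] by (simp add: sz e_def)
      qed
      also have "(s z)\<^sup>2 + (z $ j - r)\<^sup>2 < r\<^sup>2 \<longleftrightarrow> (r - z $ j)\<^sup>2 < r\<^sup>2 - (s z)\<^sup>2"
        by (simp add: power2_commute[of r]) linarith
      \<comment> \<open>The j-th coordinate is below r/2 in absolute value, so r minus it is
        positive and squaring is reversible. This selects the right branch of the sphere.\<close>
      also have "\<dots> \<longleftrightarrow> r - z $ j < sqrt (r\<^sup>2 - (s z)\<^sup>2)"
      proof -
        have rz: "sqrt ((r - z $ j)\<^sup>2) = r - z $ j" using zj by simp
        show ?thesis
          using real_sqrt_less_iff[of "(r - z $ j)\<^sup>2" "r\<^sup>2 - (s z)\<^sup>2"] unfolding rz by simp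
      qed
      also have "\<dots> \<longleftrightarrow> z $ j > \<gamma> z" by (auto simp: \<gamma>_def)
      finally show ?thesis by (simp add: z_def)
    qed
    then show ?thesis by (auto simp: dist_norm norm_minus_commute)
  qed
  ultimately show "\<exists>r'>0. \<exists>T j (\<gamma> :: real^'n \<Rightarrow> real) L.
        orthogonal_transformation T \<and> lipschitz_on L UNIV \<gamma> \<and>
        (\<forall>y z. (\<forall>i. i \<noteq> j \<longrightarrow> y $ i = z $ i) \<longrightarrow> \<gamma> y = \<gamma> z) \<and>
        ball x r \<inter> ball p r' = {y \<in> ball p r'. T (y - p) $ j > \<gamma> (T (y - p))}"
    using T(1) assms by (intro exI[of _ "r / 2"] conjI exI[of _ T] exI[of _ j] exI[of _ \<gamma>] exI[of _ 1]) auto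
qed

section \<open>Energy decay\<close>

text \<open>The minimum at 0 forces W'(0) = 0, and Taylor gives W v = W''(t)/2 times v^2.
  Boundedness of W'' on [-M, M] yields the upper bound. The lower one follows from W'' \<ge>
  W''(0)/2 near 0 and, away from 0, from the positive minimum of W on a compact set.\<close>

lemma potential_quadratic_bounds:
  fixes W W' W'' :: "real \<Rightarrow> real"
  assumes W_deriv: "\<And>v. (W has_real_derivative W' v) (at v)"
    and W'_deriv: "\<And>v. (W' has_real_derivative W'' v) (at v)"
    and W''_cont: "continuous_on UNIV W''"
    and W0: "W 0 = 0"
    and Wpos: "\<And>v. v \<noteq> 0 \<Longrightarrow> W v > 0"
    and W''0: "W'' 0 > 0"
    and M: "M > 0"
  obtains c C where "c > 0" "C > 0" "\<And>v. \<bar>v\<bar> \<le> M \<Longrightarrow> c * v\<^sup>2 \<le> W v \<and> W v \<le> C * v\<^sup>2"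
proof -
  have W_nonneg: "W v \<ge> 0" for v using Wpos[of v] W0 by (cases "v = 0") auto
  have "W' 0 = 0"
    by (rule DERIV_local_min[OF W_deriv zero_less_one]) (simp add: W0 W_nonneg)
  have taylor: "\<exists>t. \<bar>t\<bar> \<le> \<bar>v\<bar> \<and> W v = W'' t / 2 * v\<^sup>2" for v
  proof -
    define diff where "diff m = (if m = 0 then W else if m = 1 then W' else W'')" for m :: nat
    have "\<exists>t. \<bar>t\<bar> \<le> \<bar>v\<bar> \<and> W v = (\<Sum>m<2. diff m 0 / fact m * v ^ m) + diff 2 t / fact 2 * v ^ 2"
      by (rule Maclaurin_bi_le) (use W_deriv W'_deriv in \<open>auto simp: diff_def less_2_cases_iff\<close>)
    then show ?thesis
      using W0 \<open>W' 0 = 0\<close> by (simp add: diff_def numeral_2_eq_2)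
  qed
  have "bounded (W'' ` {-M..M})"
    using W''_cont by (intro compact_imp_bounded compact_continuous_image)
      (auto intro: continuous_on_subset)
  then obtain B where B: "B > 0" "\<And>t. \<bar>t\<bar> \<le> M \<Longrightarrow> W'' t \<le> B"
    by (auto simp: bounded_pos abs_le_iff)
  have upper: "W v \<le> B / 2 * v\<^sup>2" if "\<bar>v\<bar> \<le> M" for v
  proof -
    obtain t where t: "\<bar>t\<bar> \<le> \<bar>v\<bar>" "W v = W'' t / 2 * v\<^sup>2" using taylor by blast
    have "W'' t / 2 * v\<^sup>2 \<le> B / 2 * v\<^sup>2"
      using B(2)[of t] t(1) that by (intro mult_right_mono) auto
    then show ?thesis using t by simp
  qed
  have "isCont W'' 0" using W''_cont by (simp add: continuous_on_eq_continuous_at)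
  then have "W'' \<midarrow>0\<rightarrow> W'' 0" by (simp add: isCont_def)
  then have "\<forall>\<^sub>F t in at 0. W'' t > W'' 0 / 2"
    by (rule order_tendstoD) (use W''0 in auto)
  then obtain d where d: "d > 0" "\<And>t. t \<noteq> 0 \<Longrightarrow> \<bar>t\<bar> < d \<Longrightarrow> W'' t > W'' 0 / 2"
    by (auto simp: eventually_at dist_real_def)
  have d': "W'' t \<ge> W'' 0 / 2" if "\<bar>t\<bar> < d" for t
    using d(2)[of t] that W''0 by (cases "t = 0") auto
  have near: "W'' 0 / 4 * v\<^sup>2 \<le> W v" if "\<bar>v\<bar> < d" for v
  proof -
    obtain t where t: "\<bar>t\<bar> \<le> \<bar>v\<bar>" "W v = W'' t / 2 * v\<^sup>2" using taylor by blast
    have "W'' 0 / 4 * v\<^sup>2 \<le> W'' t / 2 * v\<^sup>2"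
      using d'[of t] t(1) that by (intro mult_right_mono) auto
    then show ?thesis using t by simp
  qed
  define S where "S = {-M..M} \<inter> {v. \<bar>v\<bar> \<ge> d}"
  have "compact S" unfolding S_def
    by (intro compact_Int_closed closed_Collect_le continuous_intros) auto
  have W_cont: "continuous_on A W" for A
    by (meson W_deriv DERIV_isCont continuous_at_imp_continuous_on)
  have "\<exists>m>0. \<forall>v\<in>S. m \<le> W v"
  proof (cases "S = {}")
    case False
    then obtain v0 where "v0 \<in> S" "\<forall>v\<in>S. W v0 \<le> W v"
      using continuous_attains_inf[OF \<open>compact S\<close> _ W_cont] by blast
    moreover from this have "W v0 > 0" using d(1) by (intro Wpos) (auto simp: S_def)
    ultimately show ?thesis by blast
  qed (auto intro: exI[of _ 1])
  then obtain m where m: "m > 0" "\<And>v. v \<in> S \<Longrightarrow> m \<le> W v" by blast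
  have far: "m / M\<^sup>2 * v\<^sup>2 \<le> W v" if "\<bar>v\<bar> \<le> M" "\<bar>v\<bar> \<ge> d" for v
  proof -
    have "v\<^sup>2 \<le> M\<^sup>2" using power_mono[OF that(1), of 2] by simp
    then have "m / M\<^sup>2 * v\<^sup>2 \<le> m" using m(1) M by (simp add: field_simps)
    also have "m \<le> W v" using that by (intro m) (auto simp: S_def)
    finally show ?thesis .
  qed
  show ?thesis
  proof (rule that)
    let ?c = "min (W'' 0 / 4) (m / M\<^sup>2)"
    show "?c > 0" "B / 2 > 0" using W''0 m M B by auto
    fix v assume v: "\<bar>v\<bar> \<le> M"
    have "?c * v\<^sup>2 \<le> W'' 0 / 4 * v\<^sup>2" "?c * v\<^sup>2 \<le> m / M\<^sup>2 * v\<^sup>2"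
      by (rule mult_right_mono[OF min.cobounded1 zero_le_power2],
          rule mult_right_mono[OF min.cobounded2 zero_le_power2])
    then show "?c * v\<^sup>2 \<le> W v \<and> W v \<le> B / 2 * v\<^sup>2"
      using near[of v] far[OF v] upper[OF v] by (cases "\<bar>v\<bar> < d") auto
  qed
qed

text \<open>The squared Sobolev norm on \<open>A\<close>, as a real-valued integral so that the
  energies of nested balls can be subtracted.\<close>

definition h1_energy :: "(real^'n::finite \<Rightarrow> real) \<Rightarrow> (real^'n \<Rightarrow> real^'n) \<Rightarrow> (real^'n) set \<Rightarrow> real" where
  "h1_energy u Du A = integral\<^sup>L (lebesgue_on A) (\<lambda>y. (norm (Du y))\<^sup>2 + (u y)\<^sup>2)"

lemma integrable_h1_density:
  assumes "W12 A u Du"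
  shows "integrable (lebesgue_on A) (\<lambda>y. (norm (Du y))\<^sup>2 + (u y)\<^sup>2)"
proof -
  have eq: "(norm (Du y))\<^sup>2 = (\<Sum>i\<in>UNIV. (Du y $ i)\<^sup>2)" for y
    unfolding power2_norm_eq_inner by (simp add: inner_vec_def power2_eq_square)
  show ?thesis
    using assms unfolding eq W12_def L2_def
    by (intro Bochner_Integration.integrable_add Bochner_Integration.integrable_sum) auto
qed

lemma norm_sum_sq_le: "(norm (a + b))\<^sup>2 \<le> 2 * (norm a)\<^sup>2 + 2 * (norm b)\<^sup>2" for a b :: "'a::real_inner"
  using zero_le_power2[of "norm (a - b)"]
  unfolding power2_norm_eq_inner by (simp add: algebra_simps inner_commute)

text \<open>Hole filling: the competitor \<open>\<eta> u\<close> costs nothing in the inner ball, where \<open>\<eta>\<close> vanishes, and at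
  most a fixed multiple of the energy of \<open>u\<close> in the shell.\<close>

lemma energy_contraction:
  fixes W :: "real \<Rightarrow> real"
  assumes c: "c > 0" and C: "C > 0"
    and W: "\<And>v. \<bar>v\<bar> \<le> M \<Longrightarrow> c * v\<^sup>2 \<le> W v \<and> W v \<le> C * v\<^sup>2" and M: "M > 0"
  obtains \<theta> where "0 < \<theta>" "\<theta> < 1"
    "\<And>(\<Omega> :: (real^'n::finite) set) u Du x r. \<lbrakk>\<And>y. y \<in> \<Omega> \<Longrightarrow> isCont u y; continuous_on \<Omega> Du;
       AC_local_min W \<Omega> u Du; \<And>y. y \<in> \<Omega> \<Longrightarrow> \<bar>u y\<bar> \<le> M; r \<ge> 0; ball x (r + 1) \<subseteq> \<Omega>\<rbrakk>
     \<Longrightarrow> h1_energy u Du (ball x r) \<le> \<theta> * h1_energy u Du (ball x (r + 1))"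
proof -
  obtain G where G: "G > 0" "\<And>(x::real^'n) r. r \<ge> 0 \<Longrightarrow> \<exists>\<eta>. smooth_fun \<eta> \<and>
     (\<forall>y. 0 \<le> \<eta> y \<and> \<eta> y \<le> 1) \<and>
     (\<forall>y. norm (y - x) \<le> r \<longrightarrow> \<eta> y = 0 \<and> grad \<eta> y = 0) \<and>
     (\<forall>y. norm (y - x) \<ge> r + 3/4 \<longrightarrow> \<eta> y = 1) \<and>
     (\<forall>y. norm (y - x) < r + 1 \<longrightarrow> norm (grad \<eta> y) \<le> G)"
    using cutoff_exists[where 'n='n] by blast
  define c0 where "c0 = min (1/2) c"
  \<comment> \<open>The gradient of the competitor costs at most 1 times |Du|^2 plus G^2 u^2, where
    the factor 1/2 in the energy cancels the 2 of \<open>norm_sum_sq_le\<close>, and the potential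
    costs at most C u^2.\<close>
  define C2 where "C2 = 1 + G\<^sup>2 + C"
  have c0: "c0 > 0" "c0 \<le> 1/2" "c0 \<le> c" using c by (auto simp: c0_def)
  have C2: "C2 > 1" "G\<^sup>2 + C \<le> C2" using C by (auto simp: C2_def add_nonneg_pos)
  show ?thesis
  proof (rule that[of "1 - c0 / C2"])
    show "0 < 1 - c0 / C2" "1 - c0 / C2 < 1" using c0 C2 by (auto simp: field_simps)
    fix \<Omega> :: "(real^'n) set" and u Du x r
    assume u: "\<And>y. y \<in> \<Omega> \<Longrightarrow> isCont u y" and Du: "continuous_on \<Omega> Du"
      and min: "AC_local_min W \<Omega> u Du" and bound: "\<And>y. y \<in> \<Omega> \<Longrightarrow> \<bar>u y\<bar> \<le> M"
      and r: "r \<ge> 0" and sub: "ball x (r + 1) \<subseteq> \<Omega>"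
    define A where "A = ball x (r + 1)"
    define B where "B = ball x r"
    have BA: "B \<subseteq> A" by (auto simp: A_def B_def)
    define f where "f y = (norm (Du y))\<^sup>2 + (u y)\<^sup>2" for y
    have f_nonneg: "f y \<ge> 0" for y by (simp add: f_def)
    have A_lip: "lipschitz_domain A" unfolding A_def using r by (intro lipschitz_domain_ball) auto
    have A_meas: "A \<in> sets lebesgue" and B_meas: "B \<in> sets lebesgue" by (auto simp: A_def B_def)
    have W12: "W12 A u Du" and min': "\<And>v g. W12_0 A v g \<Longrightarrow>
        AC_energy W A u Du \<le> AC_energy W A (\<lambda>x. u x + v x) (\<lambda>x. Du x + g x)"
      using min A_lip sub unfolding AC_local_min_def A_def by auto
    have f_int: "integrable (lebesgue_on A) f"
      unfolding f_def by (rule integrable_h1_density[OF W12])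
    obtain \<eta> where \<eta>: "smooth_fun \<eta>" "\<And>y. 0 \<le> \<eta> y \<and> \<eta> y \<le> 1"
      "\<And>y. norm (y - x) \<le> r \<Longrightarrow> \<eta> y = 0 \<and> grad \<eta> y = 0"
      "\<And>y. norm (y - x) \<ge> r + 3/4 \<Longrightarrow> \<eta> y = 1"
      "\<And>y. norm (y - x) < r + 1 \<Longrightarrow> norm (grad \<eta> y) \<le> G"
      using G(2)[OF r, of x] by blast
    \<comment> \<open>The perturbation \<zeta> u turns u into \<eta> u, and \<zeta> vanishes outside
      the closed ball of radius r + 3/4.\<close>
    define \<zeta> where "\<zeta> y = - 1 + \<eta> y" for y
    have "test_fun A \<zeta>"
      unfolding test_fun_def
    proof (intro conjI exI)
      show "smooth_fun \<zeta>" unfolding \<zeta>_def by (intro smooth_fun_add smooth_fun_const \<eta>)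
      show "compact (cball x (r + 3/4))" "cball x (r + 3/4) \<subseteq> A" by (auto simp: A_def)
      show "\<forall>y. y \<notin> cball x (r + 3/4) \<longrightarrow> \<zeta> y = 0"
        using \<eta>(4) by (auto simp: \<zeta>_def dist_norm norm_minus_commute)
    qed
    have grad_\<zeta>: "grad \<zeta> y = grad \<eta> y" for y
    proof -
      have "pd i \<zeta> y = pd i \<eta> y" for i
        unfolding \<zeta>_def
        using pd_add[OF smooth_fun_differentiable[OF smooth_fun_const] smooth_fun_differentiable[OF \<eta>(1)], of i "- 1" y]
          pd_eq[OF has_derivative_const, of i "- 1" y] by simp
      then show ?thesis by (simp add: vec_eq_iff)
    qed
    have "W12_0 A (\<lambda>y. \<zeta> y * u y) (\<lambda>y. \<zeta> y *\<^sub>R Du y + u y *\<^sub>R grad \<zeta> y)"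
    proof (rule W12_0_test_fun_mult)
      show "continuous_on A u"
        using u sub unfolding A_def by (intro continuous_at_imp_continuous_on) blast
      show "continuous_on A Du"
        using Du sub unfolding A_def by (rule continuous_on_subset)
      show "open A" "bounded A" by (simp_all add: A_def)
    qed (fact \<open>test_fun A \<zeta>\<close> W12)+
    from min'[OF this]
    have le: "AC_energy W A u Du \<le> AC_energy W A (\<lambda>y. \<eta> y * u y) (\<lambda>y. \<eta> y *\<^sub>R Du y + u y *\<^sub>R grad \<eta> y)"
      unfolding grad_\<zeta> by (simp add: \<zeta>_def algebra_simps)
    have lower: "c0 * f y \<le> 1/2 * (norm (Du y))\<^sup>2 + W (u y)" if "y \<in> A" for y
    proof -
      have "c0 * (norm (Du y))\<^sup>2 \<le> 1/2 * (norm (Du y))\<^sup>2" "c0 * (u y)\<^sup>2 \<le> c * (u y)\<^sup>2"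
        by (intro mult_right_mono c0 zero_le_power2)+
      moreover have "\<bar>u y\<bar> \<le> M" using bound that sub by (auto simp: A_def)
      ultimately show ?thesis using W[of "u y"] by (auto simp: f_def algebra_simps)
    qed
    define g where "g y = (if y \<in> - B then C2 * f y else 0)" for y
    have upper: "1/2 * (norm (\<eta> y *\<^sub>R Du y + u y *\<^sub>R grad \<eta> y))\<^sup>2 + W (\<eta> y * u y) \<le> g y" if y: "y \<in> A" for y
    proof (cases "y \<in> B")
      case True
      then have "\<eta> y = 0" "grad \<eta> y = 0" using \<eta>(3)[of y] by (auto simp: B_def dist_norm norm_minus_commute)
      then show ?thesis using True W[of 0] M by (simp add: g_def)
    next
      case False
      have uy: "\<bar>u y\<bar> \<le> M" using bound y sub by (auto simp: A_def)
      have \<eta>y: "\<bar>\<eta> y\<bar> \<le> 1" using \<eta>(2)[of y] by simp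
      then have \<eta>sq: "(\<eta> y)\<^sup>2 \<le> 1" by (simp add: abs_square_le_1)
      have "\<bar>\<eta> y * u y\<bar> \<le> 1 * M" unfolding abs_mult by (intro mult_mono \<eta>y uy) auto
      then have "W (\<eta> y * u y) \<le> C * (\<eta> y * u y)\<^sup>2" using W by simp
      also have "\<dots> \<le> C * (u y)\<^sup>2"
        using \<eta>sq C mult_right_mono[of "(\<eta> y)\<^sup>2" 1 "(u y)\<^sup>2"] by (simp add: power_mult_distrib)
      finally have 1: "W (\<eta> y * u y) \<le> C * (u y)\<^sup>2" .
      have "norm (grad \<eta> y) \<le> G" using \<eta>(5) y by (simp add: A_def dist_norm norm_minus_commute)
      then have "(norm (grad \<eta> y))\<^sup>2 \<le> G\<^sup>2" by (intro power_mono) auto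
      then have 2: "(norm (u y *\<^sub>R grad \<eta> y))\<^sup>2 \<le> G\<^sup>2 * (u y)\<^sup>2"
        using mult_right_mono[of "(norm (grad \<eta> y))\<^sup>2" "G\<^sup>2" "(u y)\<^sup>2"] by (simp add: power_mult_distrib mult.commute)
      have 3: "(norm (\<eta> y *\<^sub>R Du y))\<^sup>2 \<le> (norm (Du y))\<^sup>2"
        using \<eta>sq mult_right_mono[of "(\<eta> y)\<^sup>2" 1 "(norm (Du y))\<^sup>2"] by (simp add: power_mult_distrib)
      have "1/2 * (norm (\<eta> y *\<^sub>R Du y + u y *\<^sub>R grad \<eta> y))\<^sup>2 + W (\<eta> y * u y)
          \<le> (norm (Du y))\<^sup>2 + (G\<^sup>2 + C) * (u y)\<^sup>2"
        using norm_sum_sq_le[of "\<eta> y *\<^sub>R Du y" "u y *\<^sub>R grad \<eta> y"] 1 2 3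
        unfolding distrib_right by linarith
      also have "\<dots> \<le> C2 * (norm (Du y))\<^sup>2 + C2 * (u y)\<^sup>2"
        using C2 mult_right_mono[of 1 C2 "(norm (Du y))\<^sup>2"] by (intro add_mono mult_right_mono) auto
      finally show ?thesis using False by (simp add: g_def f_def algebra_simps)
    qed
    define f1 where "f1 y = (if y \<in> B then f y else 0)" for y
    define f2 where "f2 y = (if y \<in> - B then f y else 0)" for y
    have f_split: "f = (\<lambda>y. f1 y + f2 y)" by (auto simp: f1_def f2_def)
    have f1_eq: "f1 = (\<lambda>y. indicator B y *\<^sub>R f y)" by (auto simp: f1_def)
    have "B \<in> sets (lebesgue_on A)"
      using A_meas B_meas BA by (simp add: sets_restrict_space_iff)
    then have f1_int: "integrable (lebesgue_on A) f1"
      unfolding f1_eq by (rule integrable_mult_indicator) (rule f_int)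
    have "f2 = (\<lambda>y. f y - f1 y)" by (simp add: f_split)
    then have f2_int: "integrable (lebesgue_on A) f2"
      using Bochner_Integration.integrable_diff[OF f_int f1_int] by simp
    have g_eq: "g = (\<lambda>y. C2 * f2 y)" by (auto simp: g_def f2_def)
    have g_int: "integrable (lebesgue_on A) g" unfolding g_eq using f2_int by simp
    have g_nonneg: "g y \<ge> 0" for y using C2 f_nonneg by (simp add: g_def)
    \<comment> \<open>Minimality compares extended nonnegative integrals; since f and g are
      integrable, both ends of the chain are finite and it becomes an inequality of real
      numbers.\<close>
    have "ennreal (c0 * integral\<^sup>L (lebesgue_on A) f) = (\<integral>\<^sup>+ y. ennreal (c0 * f y) \<partial>lebesgue_on A)"
      using f_int f_nonneg c0 by (subst nn_integral_eq_integral) auto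
    also have "\<dots> \<le> AC_energy W A u Du"
      unfolding AC_energy_def using lower A_meas by (intro nn_integral_mono ennreal_leI) auto
    also note le
    also have "AC_energy W A (\<lambda>y. \<eta> y * u y) (\<lambda>y. \<eta> y *\<^sub>R Du y + u y *\<^sub>R grad \<eta> y)
        \<le> (\<integral>\<^sup>+ y. ennreal (g y) \<partial>lebesgue_on A)"
      unfolding AC_energy_def using upper A_meas by (intro nn_integral_mono ennreal_leI) auto
    also have "\<dots> = ennreal (integral\<^sup>L (lebesgue_on A) g)"
      using g_int g_nonneg by (intro nn_integral_eq_integral) auto
    finally have "c0 * integral\<^sup>L (lebesgue_on A) f \<le> integral\<^sup>L (lebesgue_on A) g"
      using Bochner_Integration.integral_nonneg[of "lebesgue_on A" g] g_nonneg by (simp add: ennreal_le_iff)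
    also have "\<dots> = C2 * integral\<^sup>L (lebesgue_on A) f2" unfolding g_eq by simp
    also have "integral\<^sup>L (lebesgue_on A) f2 = integral\<^sup>L (lebesgue_on A) f - integral\<^sup>L (lebesgue_on A) f1"
      using Bochner_Integration.integral_add[OF f1_int f2_int] by (simp add: f_split)
    also have "integral\<^sup>L (lebesgue_on A) f1 = integral\<^sup>L (lebesgue_on B) f"
      unfolding f1_def using Lebesgue_Measure.integral_restrict_Int[OF B_meas A_meas, of f] BA
      by (simp add: Int_absorb2)
    \<comment> \<open>The shell energy is the difference of the two ball energies; moving the inner
      one to the left gives the factor 1 - c0 / C2.\<close>
    finally have "c0 * integral\<^sup>L (lebesgue_on A) f \<le> C2 * (integral\<^sup>L (lebesgue_on A) f - integral\<^sup>L (lebesgue_on B) f)" .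
    then have "integral\<^sup>L (lebesgue_on B) f \<le> (1 - c0 / C2) * integral\<^sup>L (lebesgue_on A) f"
      using C2 by (simp add: field_simps)
    then show "h1_energy u Du (ball x r) \<le> (1 - c0 / C2) * h1_energy u Du (ball x (r + 1))"
      by (simp add: h1_energy_def A_def B_def f_def[abs_def])
  qed
qed

section \<open>Energy bounds at the largest and the smallest radius\<close>

lemma h1_energy_upper:
  fixes u :: "real^'n::finite \<Rightarrow> real"
  assumes r: "r \<ge> 0" and M: "M \<ge> 0"
    and bound: "\<And>y. y \<in> ball x r \<Longrightarrow> \<bar>u y\<bar> + norm (Du y) \<le> M"
  shows "h1_energy u Du (ball x r) \<le> M\<^sup>2 * (unit_ball_vol CARD('n) * r ^ CARD('n))"
proof -
  have "(norm (Du y))\<^sup>2 + (u y)\<^sup>2 \<le> M\<^sup>2" if "y \<in> ball x r" for y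
  proof -
    have "(norm (Du y))\<^sup>2 + (u y)\<^sup>2 \<le> (\<bar>u y\<bar> + norm (Du y))\<^sup>2"
      by (simp add: power2_sum)
    also have "\<dots> \<le> M\<^sup>2" using bound[OF that] by (intro power_mono) auto
    finally show ?thesis .
  qed
  then have "h1_energy u Du (ball x r) \<le> M\<^sup>2 * measure lebesgue (ball x r)"
    unfolding h1_energy_def by (intro integral_lebesgue_on_bounds(2)) auto
  then show ?thesis using content_ball[OF r, of x] by (simp add: measure_completion)
qed

text \<open>Since \<open>u\<close> is \<open>M\<close>-Lipschitz, \<open>\<bar>u\<bar> \<ge> \<bar>u x\<bar> / 2\<close> on the ball of radius \<open>\<bar>u x\<bar> / (2 M)\<close>.\<close>

lemma h1_energy_lower:
  fixes u :: "real^'n::finite \<Rightarrow> real"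
  assumes M: "M > 0" and W12: "W12 (ball x 1) u Du"
    and deriv: "\<And>y. y \<in> ball x 1 \<Longrightarrow> (u has_derivative (\<lambda>h. Du y \<bullet> h)) (at y)"
    and bound: "\<And>y. y \<in> ball x 1 \<Longrightarrow> \<bar>u y\<bar> + norm (Du y) \<le> M"
  shows "(\<bar>u x\<bar> / 2)\<^sup>2 * (unit_ball_vol CARD('n) * (\<bar>u x\<bar> / (2 * M)) ^ CARD('n))
    \<le> h1_energy u Du (ball x 1)"
proof -
  define \<delta> where "\<delta> = \<bar>u x\<bar> / (2 * M)"
  \<comment> \<open>This keeps the small ball inside the unit ball. If u x = 0 the small ball is
    empty and the estimate has 0 on its left side.\<close>
  have "\<bar>u x\<bar> \<le> M" using bound[of x] norm_ge_zero[of "Du x"] unfolding centre_in_ball by linarith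
  then have \<delta>: "\<delta> \<ge> 0" "\<delta> \<le> 1" "M * \<delta> = \<bar>u x\<bar> / 2" using M by (auto simp: \<delta>_def field_simps)
  have near: "(\<bar>u x\<bar> / 2)\<^sup>2 \<le> (u y)\<^sup>2" if y: "y \<in> ball x \<delta>" for y
  proof -
    have "norm (u y - u x) \<le> M * norm (y - x)"
    proof (rule differentiable_bound[OF convex_ball[of x 1]])
      fix z assume z: "z \<in> ball x 1"
      show "(u has_derivative (\<lambda>h. Du z \<bullet> h)) (at z within ball x 1)"
        by (rule has_derivative_at_withinI[OF deriv[OF z]])
      have "onorm (\<lambda>h. Du z \<bullet> h) \<le> norm (Du z)"
        by (rule onorm_bound) (auto simp: Cauchy_Schwarz_ineq2)
      then show "onorm (\<lambda>h. Du z \<bullet> h) \<le> M" using bound[OF z] by simp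
    qed (use y \<delta> in auto)
    also have "\<dots> \<le> M * \<delta>" using y M by (intro mult_left_mono) (auto simp: dist_norm norm_minus_commute)
    finally have "\<bar>u x\<bar> / 2 \<le> \<bar>u y\<bar>" unfolding \<delta>(3) real_norm_def by linarith
    from power_mono[OF this, of 2] show ?thesis by simp
  qed
  let ?f = "\<lambda>y. (norm (Du y))\<^sup>2 + (u y)\<^sup>2"
  let ?g = "\<lambda>y. if y \<in> ball x \<delta> then (\<bar>u x\<bar> / 2)\<^sup>2 else 0"
  have sub: "ball x \<delta> \<inter> ball x 1 = ball x \<delta>" using \<delta> by auto
  have "(\<bar>u x\<bar> / 2)\<^sup>2 * measure lebesgue (ball x \<delta>) = integral\<^sup>L (lebesgue_on (ball x \<delta>)) (\<lambda>y. (\<bar>u x\<bar> / 2)\<^sup>2)"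
    by (simp add: measure_restrict_space)
  also have "\<dots> = integral\<^sup>L (lebesgue_on (ball x 1)) ?g"
    by (subst Lebesgue_Measure.integral_restrict_Int) (simp_all add: sub)
  also have "\<dots> \<le> integral\<^sup>L (lebesgue_on (ball x 1)) ?f"
  proof (rule Bochner_Integration.integral_mono)
    have "integrable (lebesgue_on (ball x 1)) (\<lambda>y. (\<bar>u x\<bar> / 2)\<^sup>2)"
      by (rule finite_measure.integrable_const[OF finite_measure_lebesgue_on]) simp
    moreover have "ball x \<delta> \<in> sets (lebesgue_on (ball x 1))"
      using sub by (simp add: sets_restrict_space_iff Int_absorb2 inf.absorb_iff1)
    ultimately have "integrable (lebesgue_on (ball x 1)) (\<lambda>y. indicator (ball x \<delta>) y *\<^sub>R (\<bar>u x\<bar> / 2)\<^sup>2)"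
      by (rule integrable_mult_indicator[rotated])
    also have "(\<lambda>y. indicator (ball x \<delta>) y *\<^sub>R (\<bar>u x\<bar> / 2)\<^sup>2) = ?g" by auto
    finally show "integrable (lebesgue_on (ball x 1)) ?g" .
    show "integrable (lebesgue_on (ball x 1)) ?f" by (rule integrable_h1_density[OF W12])
    show "?g y \<le> ?f y" for y using near[of y] by (auto intro: add_increasing)
  qed
  finally show ?thesis
    using content_ball[OF \<delta>(1), of x] by (simp add: measure_completion h1_energy_def \<delta>_def)
qed

section \<open>Exponential decay of minimizers\<close>

text \<open>Write \<theta> = exp(-l). Half of the rate l absorbs the polynomial factor, and the (n +
  2)-th root of the other half leaves the rate k = l / (2 (n + 2)).\<close>

lemma exp_decay_from_geometric:
  fixes \<theta> M D :: real and n :: nat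
  assumes \<theta>: "0 < \<theta>" "\<theta> < 1" and M: "M > 0" and D: "D > 0" and n: "n > 0"
  obtains k K where "k > 0" "K > 0"
    "\<And>t R. \<lbrakk>0 \<le> t; t \<le> M; \<And>m::nat. real m + 1 \<le> R \<Longrightarrow> t ^ (n + 2) \<le> D * \<theta> ^ m * (real m + 1) ^ n\<rbrakk>
      \<Longrightarrow> t \<le> K * exp (- k * R)"
proof -
  define l where "l = - ln \<theta>"
  \<comment> \<open>Chosen so that n b = l/2: the inequality b (m + 1) \<le> exp(b (m + 1)), raised
    to the power n, then costs exactly half of the rate.\<close>
  define b where "b = l / (2 * real n)"
  define k where "k = l / (2 * real (n + 2))"
  have l: "l > 0" and \<theta>_exp: "\<theta> = exp (- l)" using \<theta> by (auto simp: l_def)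
  have b: "b > 0" and k: "k > 0" using l n by (auto simp: b_def k_def)
  \<comment> \<open>The added 1 ensures L \<ge> 1, hence L \<le> L^(n + 2), so the constant can be
    pulled under the root.\<close>
  define L where "L = D * exp (l / 2) / b ^ n + 1"
  have L: "L \<ge> 1" using D b by (simp add: L_def)
  have poly: "D * \<theta> ^ m * (real m + 1) ^ n \<le> (L * exp (- k * real m)) ^ (n + 2)" for m :: nat
  proof -
    have "b * (real m + 1) \<le> exp (b * (real m + 1))"
      using exp_ge_add_one_self[of "b * (real m + 1)"] by linarith
    then have "(b * (real m + 1)) ^ n \<le> exp (b * (real m + 1)) ^ n"
      using b by (intro power_mono) auto
    also have "\<dots> = exp (real n * (b * (real m + 1)))" by (simp add: exp_of_nat_mult)
    also have "real n * (b * (real m + 1)) = l / 2 + l / 2 * real m"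
      using n by (simp add: b_def field_simps)
    finally have "b ^ n * (real m + 1) ^ n \<le> exp (l / 2 + l / 2 * real m)" by (simp add: power_mult_distrib)
    then have 1: "(real m + 1) ^ n \<le> exp (l / 2 + l / 2 * real m) / b ^ n"
      using b by (simp add: field_simps)
    have "D * \<theta> ^ m * (real m + 1) ^ n \<le> D * \<theta> ^ m * (exp (l / 2 + l / 2 * real m) / b ^ n)"
      using 1 D \<theta> by (intro mult_left_mono) auto
    also have "\<dots> = D * exp (l / 2) / b ^ n * exp (- (l / 2) * real m)"
    proof -
      have "\<theta> ^ m = exp (- l * real m)"
        unfolding \<theta>_exp by (simp add: exp_of_nat_mult[symmetric] mult.commute)
      moreover have "exp (- l * real m) * exp (l / 2 + l / 2 * real m) = exp (l / 2) * exp (- (l / 2) * real m)"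
        unfolding exp_add[symmetric] by (simp add: algebra_simps)
      ultimately show ?thesis by (simp add: field_simps)
    qed
    also have "\<dots> \<le> L ^ (n + 2) * exp (- (l / 2) * real m)"
    proof (rule mult_right_mono)
      have "L ^ 1 \<le> L ^ (n + 2)" using L by (intro power_increasing) auto
      then show "D * exp (l / 2) / b ^ n \<le> L ^ (n + 2)" by (simp add: L_def)
    qed simp
    also have "exp (- (l / 2) * real m) = exp (- k * real m) ^ (n + 2)"
    proof -
      have "- (l / 2) * real m = real (n + 2) * (- k * real m)" by (simp add: k_def field_simps)
      then show ?thesis by (simp only: exp_of_nat_mult)
    qed
    finally show ?thesis by (simp only: power_mult_distrib)
  qed
  show ?thesis
  proof (rule that[OF k])
    \<comment> \<open>Rounding R - 1 down to an integer loses less than 1, so m \<ge> R - 2; the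
      factor exp(2 k) pays for this. The summand M covers R < 1, where only t \<le> M is
      available.\<close>
    let ?K = "(L + M) * exp (2 * k)"
    show "?K > 0" using L M by simp
    fix t R :: real
    assume t: "0 \<le> t" "t \<le> M" and
      le: "\<And>m::nat. real m + 1 \<le> R \<Longrightarrow> t ^ (n + 2) \<le> D * \<theta> ^ m * (real m + 1) ^ n"
    have K_exp: "?K * exp (- k * R) = (L + M) * exp (k * (2 - R))"
      by (simp add: mult.assoc exp_add[symmetric] algebra_simps)
    show "t \<le> ?K * exp (- k * R)"
    proof (cases "R < 1")
      case True
      then have "1 \<le> exp (k * (2 - R))" using k by simp
      have "t \<le> (L + M) * 1" using t L by simp
      also have "\<dots> \<le> (L + M) * exp (k * (2 - R))"
        using \<open>1 \<le> exp (k * (2 - R))\<close> L M by (intro mult_left_mono) auto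
      finally show ?thesis unfolding K_exp .
    next
      case False
      define m where "m = nat \<lfloor>R - 1\<rfloor>"
      have m: "real m + 1 \<le> R" "R - 2 \<le> real m" using False by (auto simp: m_def) linarith+
      have "t ^ (n + 2) \<le> (L * exp (- k * real m)) ^ (n + 2)"
        using le[OF m(1)] poly[of m] by linarith
      then have "t \<le> L * exp (- k * real m)"
        by (subst (asm) power_mono_iff) (use t L in auto)
      also have "\<dots> \<le> (L + M) * exp (k * (2 - R))"
        using L M k m(2) by (intro mult_mono) (auto simp: algebra_simps dest: mult_left_mono[of _ _ k])
      finally show ?thesis unfolding K_exp .
    qed
  qed
qed

text \<open>Chains the lower bound on the unit ball, the contraction along the radii 1, 2, ..., m +
  1 and the growth bound at radius m + 1. The constants are fixed before the domain and the
  minimizer, so they depend only on W, n and M.\<close>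

lemma AC_local_min_decay:
  fixes W W' W'' :: "real \<Rightarrow> real" and M :: real
  assumes W_deriv: "\<And>v. (W has_real_derivative W' v) (at v)"
    and W'_deriv: "\<And>v. (W' has_real_derivative W'' v) (at v)"
    and W''_cont: "continuous_on UNIV W''"
    and W0: "W 0 = 0"
    and Wpos: "\<And>v. v \<noteq> 0 \<Longrightarrow> W v > 0"
    and W''0: "W'' 0 > 0"
    and M: "M > 0"
  obtains k K where "k > 0" "K > 0"
    "\<And>(\<Omega> :: (real^'n::finite) set) u Du x R.
      \<lbrakk>\<And>y. y \<in> \<Omega> \<Longrightarrow> (u has_derivative (\<lambda>h. Du y \<bullet> h)) (at y); continuous_on \<Omega> Du;
       AC_local_min W \<Omega> u Du; \<And>y. y \<in> \<Omega> \<Longrightarrow> \<bar>u y\<bar> + norm (Du y) \<le> M; R > 0; ball x R \<subseteq> \<Omega>\<rbrakk>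
      \<Longrightarrow> \<bar>u x\<bar> \<le> K * exp (- k * R)"
proof -
  obtain c C where cC: "c > 0" "C > 0" "\<And>v. \<bar>v\<bar> \<le> M \<Longrightarrow> c * v\<^sup>2 \<le> W v \<and> W v \<le> C * v\<^sup>2"
    using potential_quadratic_bounds[OF W_deriv W'_deriv W''_cont W0 Wpos W''0 M] by blast
  obtain \<theta> where \<theta>: "0 < \<theta>" "\<theta> < 1"
    "\<And>(\<Omega> :: (real^'n) set) u Du x r. \<lbrakk>\<And>y. y \<in> \<Omega> \<Longrightarrow> isCont u y; continuous_on \<Omega> Du;
       AC_local_min W \<Omega> u Du; \<And>y. y \<in> \<Omega> \<Longrightarrow> \<bar>u y\<bar> \<le> M; r \<ge> 0; ball x (r + 1) \<subseteq> \<Omega>\<rbrakk>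
     \<Longrightarrow> h1_energy u Du (ball x r) \<le> \<theta> * h1_energy u Du (ball x (r + 1))"
    using energy_contraction[where 'n='n, OF cC M] by blast
  let ?n = "CARD('n)"
  define \<omega> where "\<omega> = unit_ball_vol (real ?n)"
  have \<omega>: "\<omega> > 0" by (simp add: \<omega>_def)
  \<comment> \<open>Collects the factors 1/4 and 1/(2 M)^n of the lower bound and M^2 of the upper
    bound; the volume of the unit ball cancels.\<close>
  define D where "D = 4 * (2 * M) ^ ?n * M\<^sup>2"
  have D: "D > 0" using M by (simp add: D_def)
  obtain k K where kK: "k > 0" "K > 0"
    "\<And>t R. \<lbrakk>0 \<le> t; t \<le> M; \<And>m::nat. real m + 1 \<le> R \<Longrightarrow> t ^ (?n + 2) \<le> D * \<theta> ^ m * (real m + 1) ^ ?n\<rbrakk>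
      \<Longrightarrow> t \<le> K * exp (- k * R)"
    using exp_decay_from_geometric[OF \<theta>(1,2) M D, of ?n] by (metis zero_less_card_finite)
  show ?thesis
  proof (rule that[OF kK(1,2)])
    fix \<Omega> :: "(real^'n) set" and u Du x R
    assume deriv: "\<And>y. y \<in> \<Omega> \<Longrightarrow> (u has_derivative (\<lambda>h. Du y \<bullet> h)) (at y)"
      and Du: "continuous_on \<Omega> Du" and min: "AC_local_min W \<Omega> u Du"
      and bound: "\<And>y. y \<in> \<Omega> \<Longrightarrow> \<bar>u y\<bar> + norm (Du y) \<le> M"
      and R: "R > 0" and sub: "ball x R \<subseteq> \<Omega>"
    have bound_u: "\<bar>u y\<bar> \<le> M" if "y \<in> \<Omega>" for y
      using bound[OF that] norm_ge_zero[of "Du y"] by linarith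
    have isCont: "isCont u y" if "y \<in> \<Omega>" for y
      using has_derivative_continuous[OF deriv[OF that]] .
    have "x \<in> \<Omega>" using sub R by auto
    show "\<bar>u x\<bar> \<le> K * exp (- k * R)"
    proof (rule kK(3))
      show "0 \<le> \<bar>u x\<bar>" "\<bar>u x\<bar> \<le> M" using bound_u \<open>x \<in> \<Omega>\<close> by auto
      fix m :: nat assume m: "real m + 1 \<le> R"
      have subm: "ball x (real j + 1) \<subseteq> \<Omega>" if "j \<le> m" for j
        using sub m that by (force simp: subset_iff)
      have iter: "h1_energy u Du (ball x 1) \<le> \<theta> ^ j * h1_energy u Du (ball x (real j + 1))"
        if "j \<le> m" for j
        using that
      proof (induction j)
        case (Suc j)
        have "h1_energy u Du (ball x (real j + 1)) \<le> \<theta> * h1_energy u Du (ball x (real j + 1 + 1))"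
          by (rule \<theta>(3)[OF isCont Du min bound_u]) (use subm[OF Suc.prems] in \<open>auto simp: add_ac\<close>)
        then have "\<theta> ^ j * h1_energy u Du (ball x (real j + 1))
            \<le> \<theta> ^ j * (\<theta> * h1_energy u Du (ball x (real j + 1 + 1)))"
          using \<theta> by (intro mult_left_mono) auto
        then show ?case using Suc by (simp add: add_ac mult_ac)
      qed simp
      have "W12 (ball x 1) u Du"
        using min lipschitz_domain_ball[of 1 x] subm[of 0] unfolding AC_local_min_def by simp
      then have "(\<bar>u x\<bar> / 2)\<^sup>2 * (\<omega> * (\<bar>u x\<bar> / (2 * M)) ^ ?n) \<le> h1_energy u Du (ball x 1)"
        unfolding \<omega>_def using subm[of 0] by (intro h1_energy_lower M deriv bound) auto
      also have "\<dots> \<le> \<theta> ^ m * h1_energy u Du (ball x (real m + 1))" by (rule iter) simp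
      also have "\<dots> \<le> \<theta> ^ m * (M\<^sup>2 * (\<omega> * (real m + 1) ^ ?n))"
        unfolding \<omega>_def using subm[of m] M \<theta>(1)
        by (intro mult_left_mono h1_energy_upper bound) auto
      finally have "\<bar>u x\<bar> ^ (?n + 2) * \<omega> \<le> D * \<theta> ^ m * (real m + 1) ^ ?n * \<omega>"
        using M by (simp add: D_def power_divide field_simps power_add power2_eq_square)
      then show "\<bar>u x\<bar> ^ (?n + 2) \<le> D * \<theta> ^ m * (real m + 1) ^ ?n"
        using \<omega> by simp
    qed
  qed
qed

text \<open>Quantifying k and K before the domain and the minimizer expresses their dependence on W,
  n and M alone. The inverse map is encoded through R: strict monotonicity and the image condition
  make it well defined on the half-line, and its decay is stated at the points R q.\<close>

theorem theorem3:
  fixes W W' W'' :: "real \<Rightarrow> real" and M\<^sub>0 :: real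
  assumes W_deriv: "\<And>v. (W has_real_derivative W' v) (at v)"
    and W'_deriv: "\<And>v. (W' has_real_derivative W'' v) (at v)"
    and W''_cont: "continuous_on UNIV W''"
    and W0: "W 0 = 0"
    and Wpos: "\<And>v. v \<noteq> 0 \<Longrightarrow> W v > 0"
    and Winf: "Liminf at_infinity (\<lambda>v. ereal (W v)) > 0"
    and W''0: "W'' 0 > 0"
    and M0: "M\<^sub>0 > 0"
  shows "\<exists>k>0. \<exists>K>0. \<forall>(\<Omega> :: (real^'n::finite) set) (u :: real^'n \<Rightarrow> real) (Du :: real^'n \<Rightarrow> real^'n).
     open \<Omega> \<and> connected \<Omega> \<and> \<Omega> \<noteq> {} \<and>
     (\<forall>x\<in>\<Omega>. (u has_derivative (\<lambda>h. Du x \<bullet> h)) (at x)) \<and> continuous_on \<Omega> Du \<and>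
     AC_local_min W \<Omega> u Du \<and>
     (\<forall>x\<in>\<Omega>. \<bar>u x\<bar> + norm (Du x) \<le> M\<^sub>0)
     \<longrightarrow> (\<exists>qs>0. \<exists>R :: real \<Rightarrow> real.
            (\<forall>q\<in>{0<..qs}. R q > 0 \<and> (\<forall>x. ball x (R q) \<subseteq> \<Omega> \<longrightarrow> \<bar>u x\<bar> < q)) \<and>
            (\<forall>q1\<in>{0<..qs}. \<forall>q2\<in>{0<..qs}. q1 < q2 \<longrightarrow> R q2 < R q1) \<and>
            continuous_on {0<..qs} R \<and>
            R ` {0<..qs} = {R qs..} \<and>
            (\<forall>q\<in>{0<..qs}. q \<le> K * exp (- k * R q)))"
proof -
  obtain k K where k: "k > 0" and K: "K > 0" and decay:
    "\<And>(\<Omega> :: (real^'n) set) u Du x R.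
      \<lbrakk>\<And>y. y \<in> \<Omega> \<Longrightarrow> (u has_derivative (\<lambda>h. Du y \<bullet> h)) (at y); continuous_on \<Omega> Du;
       AC_local_min W \<Omega> u Du; \<And>y. y \<in> \<Omega> \<Longrightarrow> \<bar>u y\<bar> + norm (Du y) \<le> M\<^sub>0; R > 0; ball x R \<subseteq> \<Omega>\<rbrakk>
      \<Longrightarrow> \<bar>u x\<bar> \<le> K * exp (- k * R)"
    using AC_local_min_decay[OF W_deriv W'_deriv W''_cont W0 Wpos W''0 M0] by blast
  \<comment> \<open>The factor 2 turns the weak decay estimate into the strict bound |u x| < q, and
    makes R positive up to q = K, which serves as q*, since R K = ln 2 / k.\<close>
  define R where "R q = ln (2 * K / q) / k" for q
  have exp_R: "2 * K * exp (- k * R q) = q" if "q > 0" for q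
    using that k K by (simp add: R_def exp_minus)
  have R_pos: "R q > 0" if "q \<in> {0<..K}" for q
    using that k K by (simp add: R_def field_simps)
  have R_mono: "R q2 < R q1" if "q1 \<in> {0<..K}" "q2 \<in> {0<..K}" "q1 < q2" for q1 q2
    using that k K by (auto simp: R_def intro!: divide_strict_right_mono divide_strict_left_mono)
  have R_cont: "continuous_on {0<..K} R"
    unfolding R_def using K k by (auto intro!: continuous_intros)
  \<comment> \<open>Monotonicity places the image in the half-line; conversely 2 K exp(-k t) is an
    explicit preimage of t.\<close>
  have R_image: "R ` {0<..K} = {R K..}"
  proof (intro equalityI subsetI)
    fix t assume "t \<in> R ` {0<..K}"
    then obtain q where "q \<in> {0<..K}" "t = R q" by blast
    then show "t \<in> {R K..}" using R_mono[of q K] K by (cases "q = K") (auto intro: less_imp_le)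
  next
    fix t assume t: "t \<in> {R K..}"
    define q where "q = 2 * K * exp (- k * t)"
    have "q > 0" using K by (simp add: q_def)
    have "- k * t \<le> - k * R K" using t k by simp
    then have "2 * K * exp (- k * t) \<le> 2 * K * exp (- k * R K)" using K by simp
    then have "q \<le> K" using exp_R[OF K] unfolding q_def by linarith
    moreover have "t = R q"
    proof -
      have "2 * K / q = exp (k * t)" using K by (simp add: q_def exp_minus field_simps)
      then show ?thesis using k by (simp add: R_def)
    qed
    ultimately show "t \<in> R ` {0<..K}" using \<open>q > 0\<close> by auto
  qed
  show ?thesis
  proof (rule exI[of _ k], rule conjI[OF k], rule exI[of _ "2 * K"], rule conjI, goal_cases)
    case 2
    show ?case
    proof (intro allI impI)
    fix \<Omega> :: "(real^'n) set" and u Du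
    assume H: "open \<Omega> \<and> connected \<Omega> \<and> \<Omega> \<noteq> {} \<and>
     (\<forall>x\<in>\<Omega>. (u has_derivative (\<lambda>h. Du x \<bullet> h)) (at x)) \<and> continuous_on \<Omega> Du \<and>
     AC_local_min W \<Omega> u Du \<and>
     (\<forall>x\<in>\<Omega>. \<bar>u x\<bar> + norm (Du x) \<le> M\<^sub>0)"
    have "\<bar>u x\<bar> < q" if q: "q \<in> {0<..K}" and sub: "ball x (R q) \<subseteq> \<Omega>" for q x
    proof -
      have "\<bar>u x\<bar> \<le> K * exp (- k * R q)"
        by (rule decay[of \<Omega> u Du]) (use H R_pos[OF q] sub in auto)
      also have "\<dots> < 2 * K * exp (- k * R q)" using K by simp
      also have "\<dots> = q" using q by (intro exp_R) auto
      finally show ?thesis .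
    qed
    then show "\<exists>qs>0. \<exists>R :: real \<Rightarrow> real.
            (\<forall>q\<in>{0<..qs}. R q > 0 \<and> (\<forall>x. ball x (R q) \<subseteq> \<Omega> \<longrightarrow> \<bar>u x\<bar> < q)) \<and>
            (\<forall>q1\<in>{0<..qs}. \<forall>q2\<in>{0<..qs}. q1 < q2 \<longrightarrow> R q2 < R q1) \<and>
            continuous_on {0<..qs} R \<and>
            R ` {0<..qs} = {R qs..} \<and>
            (\<forall>q\<in>{0<..qs}. q \<le> 2 * K * exp (- k * R q))"
      using K R_pos R_mono R_cont R_image exp_R
      by (intro exI[of _ K] exI[of _ R] conjI) auto
    qed
  qed (use K in simp)
qed

end
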